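(* Let $k\ge1$ be an integer, $0<\epsilon<1$, and for $t\in\mathbb{R}$ let $P_t$ be the orthogonal projection of $H^2_2=\mathcal{H}^{(-2)}_2$ onto the orthogonal complement $\langle z_1^k-\epsilon e^{it}\rangle^\perp$ of the principal ideal generated by $z_1^k-\epsilon e^{it}$ in $\mathbb{C}[z_1,z_2]$. (a) The map $\widetilde P:\mathbb{R}\to B\big(\mathcal{H}^{(-2)}_2,\mathcal{H}^{(4)}_2\big)$, where $\widetilde P_t$ is the composition of $P_t$ with the inclusion $\mathcal{H}^{(-2)}_2\hookrightarrow\mathcal{H}^{(4)}_2$, is first-order differentiable. (b) Given a positive integer $l$ and a positive real $\sigma$, the map $\widetilde P:\mathbb{R}\to B\big(\mathcal{H}^{(-2)}_2,\mathcal{H}^{(2l+1+\sigma)}_2\big)$, where $\widetilde P_t$ is the composition of $P_t$ with the inclusion $\mathcal{H}^{(-2)}_2\hookrightarrow\mathcal{H}^{(2l+1+\sigma)}_2$, is $l$-th order differentiable.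
   Context: For $s>-3$, $\mathcal{H}^{(s)}_2$ is the Besov-Sobolev Hilbert space of analytic functions on the unit ball $\mathbb{B}^2\subset\mathbb{C}^2$ with reproducing kernel $(1-\langle z,w\rangle)^{-s-3}$; equivalently, distinct monomials are orthogonal (and form an orthogonal basis) and $$\|z_1^{n_1}z_2^{n_2}\|^2_{\mathcal{H}^{(s)}_2}=\frac{n_1!\,n_2!\,(s+2)!}{(n_1+n_2+s+2)!},$$ where $x!=\Gamma(x+1)$ for real $x>-1$. In particular $\mathcal{H}^{(-2)}_2=H^2_2$ is the Drury-Arveson space, with $\|z_1^{m}z_2^{n}\|^2=\binom{m+n}{m}^{-1}$. $B(X,Y)$ is the Banach space of bounded linear operators $X\to Y$ with the operator norm; differentiability of maps $\mathbb{R}\to B(X,Y)$ is with respect to this norm. *)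

theory Defs
  imports "HOL-Analysis.Analysis" "HOL-Computational_Algebra.Polynomial"
begin

section \<open>Besov-Sobolev spaces on the unit ball of \<open>\<complex>\<^sup>2\<close>\<close>

text \<open>
  Functions on the open unit ball are represented by functions on \<open>\<complex>\<^sup>2\<close> that vanish outside
  the ball, so that equality of functions is equality on the ball.  The product type
  \<open>complex \<times> complex\<close> carries the Euclidean norm.
\<close>

type_synonym ball_fun = "complex \<times> complex \<Rightarrow> complex"

definition taylor_coeff :: "ball_fun \<Rightarrow> nat \<Rightarrow> nat \<Rightarrow> complex" where
  "taylor_coeff f m n =
     (deriv ^^ m) (\<lambda>z1. (deriv ^^ n) (\<lambda>z2. f (z1, z2)) 0) 0 / (fact m * fact n)"

text \<open>The ball is a complete Reinhardt domain, so a function on it is analytic iff its Taylor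
  series at the origin converges (absolutely) to it on the whole ball.\<close>

definition analytic_ball :: "ball_fun set" where
  "analytic_ball =
     {f. (\<forall>z. z \<notin> ball 0 1 \<longrightarrow> f z = 0) \<and>
         (\<forall>z1 z2. (z1, z2) \<in> ball 0 1 \<longrightarrow>
            ((\<lambda>(m, n). taylor_coeff f m n * z1 ^ m * z2 ^ n) has_sum f (z1, z2)) UNIV)}"

text \<open>The squared norm of the monomial \<open>z\<^sub>1\<^sup>m z\<^sub>2\<^sup>n\<close>, where \<open>x! = Gamma (x + 1)\<close>; meaningful for
  \<open>s > -3\<close>.\<close>

definition besov_weight :: "real \<Rightarrow> nat \<Rightarrow> nat \<Rightarrow> real" where
  "besov_weight s m n =
     fact m * fact n * Gamma (s + 2 + 1) / Gamma (real m + real n + s + 2 + 1)"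

definition besov :: "real \<Rightarrow> ball_fun set" where
  "besov s = {f \<in> analytic_ball.
     (\<lambda>(m, n). (cmod (taylor_coeff f m n))\<^sup>2 * besov_weight s m n) summable_on UNIV}"

definition besov_inner :: "real \<Rightarrow> ball_fun \<Rightarrow> ball_fun \<Rightarrow> complex" where
  "besov_inner s f g =
     infsum (\<lambda>(m, n). taylor_coeff f m n * cnj (taylor_coeff g m n)
                        * complex_of_real (besov_weight s m n)) UNIV"

definition besov_norm :: "real \<Rightarrow> ball_fun \<Rightarrow> real" where
  "besov_norm s f = sqrt (Re (besov_inner s f f))"

definition besov_orth :: "real \<Rightarrow> ball_fun set \<Rightarrow> ball_fun set" where
  "besov_orth s S = {f \<in> besov s. \<forall>g\<in>S. besov_inner s f g = 0}"

text \<open>Orthogonal projection of \<open>besov s\<close> onto a closed subspace \<open>V\<close>.\<close>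

definition orth_proj :: "real \<Rightarrow> ball_fun set \<Rightarrow> ball_fun \<Rightarrow> ball_fun" where
  "orth_proj s V f =
     (if f \<in> besov s
      then THE g. g \<in> V \<and> (\<forall>h\<in>V. besov_inner s (\<lambda>z. f z - g z) h = 0)
      else (\<lambda>_. 0))"


section \<open>Bounded operators and norm differentiability\<close>

text \<open>Bounded complex-linear operators from \<open>besov s\<close> to \<open>besov r\<close>; an operator is extended by
  zero outside its domain \<open>besov s\<close>.\<close>

type_synonym ball_op = "ball_fun \<Rightarrow> ball_fun"

definition bounded_ops :: "real \<Rightarrow> real \<Rightarrow> ball_op set" where
  "bounded_ops s r =
     {T. (\<forall>f. f \<notin> besov s \<longrightarrow> T f = (\<lambda>_. 0)) \<and>
         (\<forall>f\<in>besov s. T f \<in> besov r) \<and>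
         (\<forall>f\<in>besov s. \<forall>g\<in>besov s. T (\<lambda>z. f z + g z) = (\<lambda>z. T f z + T g z)) \<and>
         (\<forall>c. \<forall>f\<in>besov s. T (\<lambda>z. c * f z) = (\<lambda>z. c * T f z)) \<and>
         (\<exists>C. \<forall>f\<in>besov s. besov_norm r (T f) \<le> C * besov_norm s f)}"

definition op_norm :: "real \<Rightarrow> real \<Rightarrow> ball_op \<Rightarrow> real" where
  "op_norm s r T = (SUP f\<in>{f \<in> besov s. besov_norm s f \<le> 1}. besov_norm r (T f))"

definition has_op_derivative ::
    "real \<Rightarrow> real \<Rightarrow> (real \<Rightarrow> ball_op) \<Rightarrow> ball_op \<Rightarrow> real \<Rightarrow> bool" where
  "has_op_derivative s r F D t \<longleftrightarrow>
     D \<in> bounded_ops s r \<and>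
     ((\<lambda>h. op_norm s r (\<lambda>f z. (F (t + h) f z - F t f z) / complex_of_real h - D f z))
        \<longlongrightarrow> 0) (at 0)"

text \<open>\<open>op_differentiable s r l F\<close>: \<open>F\<close> is a map from the reals to \<open>bounded_ops s r\<close> that is
  \<open>l\<close> times differentiable everywhere.\<close>

fun op_differentiable :: "real \<Rightarrow> real \<Rightarrow> nat \<Rightarrow> (real \<Rightarrow> ball_op) \<Rightarrow> bool" where
  "op_differentiable s r 0 F \<longleftrightarrow> (\<forall>t. F t \<in> bounded_ops s r)"
| "op_differentiable s r (Suc l) F \<longleftrightarrow>
     (\<forall>t. F t \<in> bounded_ops s r) \<and>
     (\<exists>F'. (\<forall>t. has_op_derivative s r F (F' t) t) \<and> op_differentiable s r l F')"


section \<open>The ideals and the projections\<close>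

text \<open>\<open>\<complex>[z\<^sub>1, z\<^sub>2]\<close> is the type \<open>complex poly poly\<close>, with outer variable \<open>z\<^sub>2\<close> and coefficients in
  \<open>\<complex>[z\<^sub>1]\<close>.\<close>

definition poly2_fun :: "complex poly poly \<Rightarrow> ball_fun" where
  "poly2_fun q = (\<lambda>(z1, z2). if (z1, z2) \<in> ball 0 1 then poly (poly q [:z2:]) z1 else 0)"

definition Z1 :: "complex poly poly" where
  "Z1 = [:[:0, 1:]:]"

definition principal_ideal :: "complex poly poly \<Rightarrow> complex poly poly set" where
  "principal_ideal p = {p * q | q. True}"

definition P :: "nat \<Rightarrow> real \<Rightarrow> real \<Rightarrow> ball_op" where
  "P k \<epsilon> t =
     orth_proj (-2) (besov_orth (-2)
       (poly2_fun ` principal_ideal (Z1 ^ k - [:[:of_real \<epsilon> * exp (\<i> * of_real t):]:])))"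

text \<open>The inclusion of \<open>besov s\<close> into a larger \<open>besov r\<close> (extended by zero outside
  \<open>besov s\<close>).\<close>

definition besov_inclusion :: "real \<Rightarrow> ball_op" where
  "besov_inclusion s f = (if f \<in> besov s then f else (\<lambda>_. 0))"

end

theory Submission
  imports Defs "HOL-Real_Asymp.Real_Asymp"
begin

text \<open>
  Write \<open>lam = \<epsilon> e\<^sup>i\<^sup>t\<close> and divide Taylor coefficients by \<open>binomial (m + n) n\<close>. Orthogonality to the
  ideal says that the resulting array is multiplied by \<open>cnj lam\<close> when \<open>m\<close> increases by \<open>k\<close>, so the
  complement splits into lines indexed by \<open>r = m mod k\<close> and \<open>n\<close>, spanned by orthogonal vectors whose
  norms do not depend on \<open>t\<close>. In the monomial basis the entry of \<open>P\<^sub>t\<close> between \<open>r + k p\<close> and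
  \<open>r + k q\<close> therefore depends on \<open>t\<close> only through \<open>e\<^sup>i\<^sup>(\<^sup>q\<^sup>-\<^sup>p\<^sup>)\<^sup>t\<close>, and differentiating \<open>l\<close> times multiplies it
  by \<open>(i (q - p))\<^sup>l\<close>. Under the weights \<open>\<epsilon>\<^sup>2\<^sup>q binomial (r + k q + n) n\<close> the index \<open>q\<close> is of size
  \<open>O(n + 1)\<close> in every moment, so a factor \<open>\<bar>q - p\<bar>\<^sup>K\<close> costs at most \<open>(m + n + 1)\<^sup>K\<close>, which is what the
  weight of \<open>besov s\<close> gains when \<open>s + 2 \<ge> 2 K\<close>. The error of the difference quotient of the
  \<open>(l - 1)\<close>-st derivative is \<open>O(h \<bar>q - p\<bar>\<^sup>l\<^sup>+\<^sup>1)\<close>, so \<open>K = l + 1\<close> suffices. Part (a) is the case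
  \<open>l = 1\<close>, \<open>\<sigma> = 1\<close> of part (b).
\<close>

section \<open>Power series on the ball\<close>

text \<open>A convergent power series is a formal power series expansion of its sum, and the
  coefficients of such an expansion are the scaled derivatives at 0.\<close>

lemma deriv_power_series_at_0:
  fixes f :: "complex \<Rightarrow> complex"
  assumes "r > 0" and sums: "\<And>z. cmod z < r \<Longrightarrow> (\<lambda>n. a n * z ^ n) sums f z"
  shows "(deriv ^^ n) f 0 = fact n * a n"
proof -
  have "f has_fps_expansion Abs_fps a"
    unfolding has_fps_expansion_def
  proof
    \<comment> \<open>Convergence at the one point \<open>r/2\<close> already bounds the radius of
      convergence away from 0.\<close>
    have "summable (\<lambda>n. a n * of_real (r/2) ^ n)"
      using sums[of "of_real (r/2)"] \<open>r > 0\<close> by (auto simp: sums_iff)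
    from conv_radius_geI[OF this] have "ereal (r/2) \<le> fps_conv_radius (Abs_fps a)"
      using \<open>r > 0\<close> by (simp add: fps_conv_radius_def)
    with \<open>r > 0\<close> show "fps_conv_radius (Abs_fps a) > 0"
      by (metis half_gt_zero less_le_trans ereal_less(2))
    have "eventually (\<lambda>z::complex. z \<in> ball 0 r) (nhds 0)"
      using \<open>r > 0\<close> by (intro eventually_nhds_in_open) auto
    then show "eventually (\<lambda>z. eval_fps (Abs_fps a) z = f z) (nhds 0)"
      by eventually_elim (use sums in \<open>auto simp: eval_fps_def sums_iff\<close>)
  qed
  from fps_nth_fps_expansion[OF this, of n] show ?thesis by simp
qed

lemma in_unit_ball_iff: "(z1, z2) \<in> ball (0 :: complex \<times> complex) 1 \<longleftrightarrow> (cmod z1)\<^sup>2 + (cmod z2)\<^sup>2 < 1"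
  by (simp add: norm_prod_def dist_norm)

text \<open>\<open>taylor_coeff\<close> differentiates in \<open>z2\<close> first, so the double
  series is regrouped by powers of \<open>z2\<close>. The coefficients \<open>g n z1\<close> are
  power series in \<open>z1\<close> on the unit disc, and the one-variable result applies
  twice.\<close>

lemma taylor_coeff_eqI:
  assumes sum: "\<And>z1 z2. (z1, z2) \<in> ball 0 1 \<Longrightarrow>
            ((\<lambda>(m, n). c m n * z1 ^ m * z2 ^ n) has_sum f (z1, z2)) UNIV"
  shows "taylor_coeff f = c"
proof (intro ext)
  fix m n
  define g where "g n z1 = (\<Sum>\<^sub>\<infinity>m. c m n * z1 ^ m)" for n z1
  have swap: "((\<lambda>(n, m). c m n * z1 ^ m * z2 ^ n) has_sum f (z1, z2)) (UNIV \<times> UNIV)"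
    if "(cmod z1)\<^sup>2 + (cmod z2)\<^sup>2 < 1" for z1 z2
    using sum[of z1 z2, unfolded in_unit_ball_iff, OF that] has_sum_swap[where f = "\<lambda>(m, n). c m n * z1 ^ m * z2 ^ n" and A = UNIV and B = UNIV]
    by simp
  have g: "((\<lambda>m. c m n * z1 ^ m) has_sum g n z1) UNIV" if "cmod z1 < 1" for n z1
  proof -
    \<comment> \<open>Any nonzero \<open>z2\<close> that keeps \<open>(z1, z2)\<close> in the ball
      would do: the slice with fixed \<open>n\<close> is summable there, and dividing it by
      \<open>z2 ^ n\<close> leaves the series for \<open>g n z1\<close>.\<close>
    define z2 where "z2 = complex_of_real ((1 - (cmod z1)\<^sup>2) / 2)"
    have sq: "(cmod z1)\<^sup>2 < 1" using that by (simp add: power_less_one_iff abs_square_less_1)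
    then have "z2 \<noteq> 0" by (auto simp: z2_def simp flip: of_real_diff of_real_divide)
    have "cmod z2 = (1 - (cmod z1)\<^sup>2) / 2" using sq unfolding z2_def norm_of_real by simp
    moreover have "((1 - x) / 2)\<^sup>2 < 1 - x" if "x < 1" "x \<ge> 0" for x :: real
    proof -
      have "((1 - x) / 2)\<^sup>2 = (1 - x) * ((1 - x) / 4)" by (simp add: power2_eq_square)
      also have "\<dots> < (1 - x) * 1" using that by (intro mult_strict_left_mono) auto
      finally show ?thesis by simp
    qed
    ultimately have "(cmod z1)\<^sup>2 + (cmod z2)\<^sup>2 < 1"
      using sq by (smt (verit) zero_le_power2)
    from has_sum_imp_summable[OF swap[OF this]]
    have "(\<lambda>m. c m n * z1 ^ m * z2 ^ n) summable_on UNIV"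
      by (rule summable_on_SigmaD1) auto
    from summable_on_cmult_left[OF this, of "inverse (z2 ^ n)"] \<open>z2 \<noteq> 0\<close>
    have "(\<lambda>m. c m n * z1 ^ m) summable_on UNIV" by (simp add: mult.assoc)
    then show ?thesis by (simp add: g_def)
  qed
  have inner: "(deriv ^^ n) (\<lambda>z2. f (z1, z2)) 0 = fact n * g n z1" if "cmod z1 < 1" for n z1
  proof (rule deriv_power_series_at_0)
    have sq: "(cmod z1)\<^sup>2 < 1" using that by (simp add: power_less_one_iff abs_square_less_1)
    then show "sqrt (1 - (cmod z1)\<^sup>2) > 0" by simp
    fix z2 assume "cmod z2 < sqrt (1 - (cmod z1)\<^sup>2)"
    then have "(cmod z2)\<^sup>2 < (sqrt (1 - (cmod z1)\<^sup>2))\<^sup>2" by (intro power_strict_mono) auto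
    then have "(cmod z1)\<^sup>2 + (cmod z2)\<^sup>2 < 1" using sq by simp
    from has_sum_SigmaD[OF swap[OF this], of "\<lambda>n. g n z1 * z2 ^ n"]
    have "((\<lambda>n. g n z1 * z2 ^ n) has_sum f (z1, z2)) UNIV"
      using has_sum_cmult_left[OF g[OF that]] by simp
    then show "(\<lambda>n. g n z1 * z2 ^ n) sums f (z1, z2)" by (rule has_sum_imp_sums)
  qed
  have "(deriv ^^ m) (\<lambda>z1. (deriv ^^ n) (\<lambda>z2. f (z1, z2)) 0) 0 = fact m * (fact n * c m n)"
  proof (rule deriv_power_series_at_0)
    show "(1::real) > 0" by simp
    fix z assume "cmod z < 1"
    from has_sum_imp_sums[OF has_sum_cmult_right[OF g[OF this], of "fact n"]]
    show "(\<lambda>m. fact n * c m n * z ^ m) sums (deriv ^^ n) (\<lambda>z2. f (z, z2)) 0"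
      using inner[OF \<open>cmod z < 1\<close>] by (simp add: mult.assoc)
  qed
  then show "taylor_coeff f m n = c m n" by (simp add: taylor_coeff_def)
qed

lemma analytic_ballI:
  assumes "\<And>z. z \<notin> ball 0 1 \<Longrightarrow> f z = 0"
    and "\<And>z1 z2. (z1, z2) \<in> ball 0 1 \<Longrightarrow>
            ((\<lambda>(m, n). c m n * z1 ^ m * z2 ^ n) has_sum f (z1, z2)) UNIV"
  shows "f \<in> analytic_ball" "taylor_coeff f = c"
  using assms taylor_coeff_eqI[of c f, OF assms(2)] by (auto simp: analytic_ball_def)

lemma analytic_ball_has_sum:
  "f \<in> analytic_ball \<Longrightarrow> (z1, z2) \<in> ball 0 1 \<Longrightarrow>
     ((\<lambda>(m, n). taylor_coeff f m n * z1 ^ m * z2 ^ n) has_sum f (z1, z2)) UNIV"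
  by (simp add: analytic_ball_def)

text \<open>Values off the ball are fixed to be 0, so Taylor coefficients determine the whole
  function. Operator identities are checked coefficientwise through this lemma.\<close>

lemma analytic_ball_eqI:
  assumes "f \<in> analytic_ball" "g \<in> analytic_ball" "\<And>m n. taylor_coeff f m n = taylor_coeff g m n"
  shows "f = g"
proof
  fix z :: "complex \<times> complex"
  obtain z1 z2 where z: "z = (z1, z2)" by (cases z)
  show "f z = g z"
  proof (cases "z \<in> ball 0 1")
    case True
    then show ?thesis
      using analytic_ball_has_sum[OF assms(1), of z1 z2] analytic_ball_has_sum[OF assms(2), of z1 z2]
      by (simp add: assms(3) z has_sum_unique)
  next
    case False
    then show ?thesis using assms unfolding analytic_ball_def mem_Collect_eq by metis
  qed
qed

lemma analytic_ball_lincomb: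
  assumes "f \<in> analytic_ball" "g \<in> analytic_ball"
  shows "(\<lambda>z. a * f z + b * g z) \<in> analytic_ball"
    and "taylor_coeff (\<lambda>z. a * f z + b * g z) = (\<lambda>m n. a * taylor_coeff f m n + b * taylor_coeff g m n)"
proof -
  let ?h = "\<lambda>z. a * f z + b * g z"
  let ?c = "\<lambda>m n. a * taylor_coeff f m n + b * taylor_coeff g m n"
  have *: "((\<lambda>(m, n). ?c m n * z1 ^ m * z2 ^ n) has_sum ?h (z1, z2)) UNIV"
    if "(z1, z2) \<in> ball 0 1" for z1 z2
    using has_sum_add[OF
        has_sum_cmult_right[OF analytic_ball_has_sum[OF assms(1) that], of a]
        has_sum_cmult_right[OF analytic_ball_has_sum[OF assms(2) that], of b]]
    by (simp add: case_prod_unfold algebra_simps)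
  show "?h \<in> analytic_ball" "taylor_coeff ?h = ?c"
    by (rule analytic_ballI[where c = ?c]; use assms * in \<open>auto simp: analytic_ball_def\<close>)+
qed

lemma analytic_ball_zero: "(\<lambda>_. 0) \<in> analytic_ball" "taylor_coeff (\<lambda>_. 0) = (\<lambda>_ _. 0)"
  by (rule analytic_ballI[where c = "\<lambda>_ _. 0"]; simp add: case_prod_unfold)+

section \<open>Functions built from coefficient arrays\<close>

definition power_fun :: "(nat \<Rightarrow> nat \<Rightarrow> complex) \<Rightarrow> ball_fun" where
  "power_fun c = (\<lambda>(z1, z2). if (z1, z2) \<in> ball 0 1
     then \<Sum>\<^sub>\<infinity>(m, n). c m n * z1 ^ m * z2 ^ n else 0)"

lemma power_fun:
  assumes "\<And>z1 z2. (z1, z2) \<in> ball 0 1 \<Longrightarrow> (\<lambda>(m, n). c m n * z1 ^ m * z2 ^ n) summable_on UNIV"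
  shows "power_fun c \<in> analytic_ball" "taylor_coeff (power_fun c) = c"
  by (rule analytic_ballI[where c = c]; use assms in \<open>auto simp: power_fun_def simp del: mem_ball\<close>)+

text \<open>The nested polynomial lists powers of \<open>z2\<close> outermost, so the finite sum is
  formed over \<open>(n, m)\<close> and then transposed.\<close>

lemma poly2_fun_analytic:
  shows "poly2_fun q \<in> analytic_ball"
    and "taylor_coeff (poly2_fun q) = (\<lambda>m n. coeff (coeff q n) m)"
proof -
  have *: "((\<lambda>(m, n). coeff (coeff q n) m * z1 ^ m * z2 ^ n) has_sum poly (poly q [:z2:]) z1) UNIV"
    for z1 z2
  proof -
    have "poly (poly q [:z2:]) z1 = (\<Sum>n\<le>degree q. poly (coeff q n) z1 * z2 ^ n)"
      by (simp add: poly_altdef[of q] poly_sum)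
    also have "\<dots> = (\<Sum>n\<le>degree q. \<Sum>m\<le>degree (coeff q n). coeff (coeff q n) m * z1 ^ m * z2 ^ n)"
      by (simp add: poly_altdef sum_distrib_right)
    also have "\<dots> = (\<Sum>(n, m)\<in>(SIGMA n:{..degree q}. {..degree (coeff q n)}).
        coeff (coeff q n) m * z1 ^ m * z2 ^ n)"
      by (rule sum.Sigma) auto
    finally have "poly (poly q [:z2:]) z1 = \<dots>" .
    then have "((\<lambda>(n, m). coeff (coeff q n) m * z1 ^ m * z2 ^ n) has_sum poly (poly q [:z2:]) z1)
        (UNIV \<times> UNIV)"
      by (intro has_sum_finite_neutralI[where B = "SIGMA n:{..degree q}. {..degree (coeff q n)}"])
         (auto intro!: le_degree)
    then show ?thesis
      using has_sum_swap[where f = "\<lambda>(n, m). coeff (coeff q n) m * z1 ^ m * z2 ^ n" and A = UNIV and B = UNIV] by simp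
  qed
  show "poly2_fun q \<in> analytic_ball" "taylor_coeff (poly2_fun q) = (\<lambda>m n. coeff (coeff q n) m)"
    by (rule analytic_ballI[where c = "\<lambda>m n. coeff (coeff q n) m"]; use * in \<open>auto simp: poly2_fun_def\<close>)+
qed

section \<open>Estimates for binomial weights\<close>

text \<open>The finite inequality bounds every finite partial sum of the nonnegative family, hence
  also its total.\<close>

lemma Cauchy_Schwarz_infsum:
  fixes x y :: "'a \<Rightarrow> real"
  assumes "(\<lambda>i. (x i)\<^sup>2) summable_on A" "(\<lambda>i. (y i)\<^sup>2) summable_on A"
  shows "(\<lambda>i. \<bar>x i * y i\<bar>) summable_on A"
    and "(\<Sum>\<^sub>\<infinity>i\<in>A. \<bar>x i * y i\<bar>)\<^sup>2 \<le> (\<Sum>\<^sub>\<infinity>i\<in>A. (x i)\<^sup>2) * (\<Sum>\<^sub>\<infinity>i\<in>A. (y i)\<^sup>2)"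
proof -
  show summ: "(\<lambda>i. \<bar>x i * y i\<bar>) summable_on A"
    using abs_summable_product[of x A y] assms by (simp add: power2_eq_square abs_mult)
  have nn: "0 \<le> (\<Sum>\<^sub>\<infinity>i\<in>A. (x i)\<^sup>2)" "0 \<le> (\<Sum>\<^sub>\<infinity>i\<in>A. (y i)\<^sup>2)" "0 \<le> (\<Sum>\<^sub>\<infinity>i\<in>A. \<bar>x i * y i\<bar>)"
    by (auto intro!: infsum_nonneg)
  have "(\<Sum>\<^sub>\<infinity>i\<in>A. \<bar>x i * y i\<bar>) \<le> sqrt ((\<Sum>\<^sub>\<infinity>i\<in>A. (x i)\<^sup>2) * (\<Sum>\<^sub>\<infinity>i\<in>A. (y i)\<^sup>2))"
  proof (rule infsum_le_finite_sums[OF summ])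
    fix F assume F: "finite F" "F \<subseteq> A"
    have "(\<Sum>i\<in>F. \<bar>x i * y i\<bar>)\<^sup>2 \<le> (\<Sum>i\<in>F. (x i)\<^sup>2) * (\<Sum>i\<in>F. (y i)\<^sup>2)"
      using Cauchy_Schwarz_ineq_sum[of "\<lambda>i. \<bar>x i\<bar>" "\<lambda>i. \<bar>y i\<bar>" F] by (simp add: abs_mult)
    also have "\<dots> \<le> (\<Sum>\<^sub>\<infinity>i\<in>A. (x i)\<^sup>2) * (\<Sum>\<^sub>\<infinity>i\<in>A. (y i)\<^sup>2)"
      using F assms by (intro mult_mono finite_sum_le_infsum sum_nonneg nn) auto
    finally show "(\<Sum>i\<in>F. \<bar>x i * y i\<bar>) \<le> sqrt ((\<Sum>\<^sub>\<infinity>i\<in>A. (x i)\<^sup>2) * (\<Sum>\<^sub>\<infinity>i\<in>A. (y i)\<^sup>2))"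
      by (rule real_le_rsqrt)
  qed
  from power_mono[OF this nn(3), of 2] nn show "(\<Sum>\<^sub>\<infinity>i\<in>A. \<bar>x i * y i\<bar>)\<^sup>2 \<le> (\<Sum>\<^sub>\<infinity>i\<in>A. (x i)\<^sup>2) * (\<Sum>\<^sub>\<infinity>i\<in>A. (y i)\<^sup>2)"
    by simp
qed

text \<open>Ratio test: consecutive terms have quotients tending to \<open>\<rho>\<close>, which are
  eventually below the midpoint of \<open>\<rho>\<close> and 1.\<close>

lemma summable_poly_times_geometric:
  fixes \<rho> c :: real
  assumes "0 < \<rho>" "\<rho> < 1" "c > 0"
  shows "summable (\<lambda>i. \<rho> ^ i * (c + real i) ^ j)"
proof -
  have "((\<lambda>i. \<rho> * ((c + real (Suc i)) / (c + real i)) ^ j) \<longlongrightarrow> \<rho> * 1 ^ j) sequentially"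
    by (intro tendsto_intros) real_asymp
  then have "eventually (\<lambda>i. \<rho> * ((c + real (Suc i)) / (c + real i)) ^ j < (1 + \<rho>) / 2) sequentially"
    by (rule order_tendstoD) (use assms in auto)
  then obtain N where N: "\<And>i. i \<ge> N \<Longrightarrow> \<rho> * ((c + real (Suc i)) / (c + real i)) ^ j < (1 + \<rho>) / 2"
    by (auto simp: eventually_sequentially)
  show ?thesis
  proof (rule summable_ratio_test[where c = "(1 + \<rho>) / 2" and N = N])
    fix i assume "i \<ge> N"
    have "norm (\<rho> ^ Suc i * (c + real (Suc i)) ^ j) =
        (\<rho> * ((c + real (Suc i)) / (c + real i)) ^ j) * norm (\<rho> ^ i * (c + real i) ^ j)"
      using assms by (simp add: power_divide abs_mult field_simps)
    also have "\<dots> \<le> (1 + \<rho>) / 2 * norm (\<rho> ^ i * (c + real i) ^ j)"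
      using N[OF \<open>i \<ge> N\<close>] by (intro mult_right_mono) auto
    finally show "norm (\<rho> ^ Suc i * (c + real (Suc i)) ^ j) \<le> \<dots>" .
  qed (use assms in auto)
qed

text \<open>Raising the first index from \<open>a\<close> to \<open>a + 1\<close> multiplies the
  coefficient by \<open>1 + n / (a + 1)\<close>, at most \<open>1 + 1 / M\<close> once
  \<open>M * n \<le> a\<close>.\<close>

lemma binomial_growth:
  assumes "M \<ge> 1" "M * n \<le> m"
  shows "real ((m + i + n) choose n) \<le> (1 + 1 / real M) ^ i * real ((m + n) choose n)"
proof (induction i)
  case (Suc i)
  define a where "a = m + i"
  have "M * n \<le> Suc a" using assms by (simp add: a_def)
  then have "real M * real n \<le> real (Suc a)" by (metis of_nat_le_iff of_nat_mult)
  then have le: "real (Suc (a + n)) \<le> (1 + 1 / real M) * real (Suc a)"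
    using assms by (simp add: field_simps)
  have "Suc a * (Suc (a + n) choose Suc a) = Suc (a + n) * ((a + n) choose a)"
    using Suc_times_binomial[of a "a + n"] by simp
  moreover have "(Suc (a + n) choose Suc a) = (Suc a + n choose n)" "(a + n) choose a = (a + n) choose n"
    using binomial_symmetric[of "Suc a" "Suc a + n"] binomial_symmetric[of a "a + n"] by auto
  ultimately have "real (Suc a) * real (Suc a + n choose n) = real (Suc (a + n)) * real ((a + n) choose n)"
    by (metis of_nat_mult)
  also have "\<dots> \<le> ((1 + 1 / real M) * real (Suc a)) * real ((a + n) choose n)"
    by (intro mult_right_mono le) auto
  finally have "real (Suc a) * real (Suc a + n choose n) \<le>
      real (Suc a) * ((1 + 1 / real M) * real ((a + n) choose n))"
    by (simp only: mult_ac)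
  then have "real (Suc a + n choose n) \<le> (1 + 1 / real M) * real ((a + n) choose n)"
    by (rule mult_left_le_imp_le) auto
  also have "\<dots> \<le> (1 + 1 / real M) * ((1 + 1 / real M) ^ i * real ((m + n) choose n))"
    by (intro mult_left_mono) (use Suc.IH in \<open>auto simp: a_def\<close>)
  finally show ?case by (simp add: a_def)
qed auto

text \<open>The weights \<open>x ^ q * binomial (r + k q + n) n\<close> decay geometrically
  once \<open>q\<close> exceeds a fixed multiple of \<open>n + 1\<close>, which is why the constant does not depend on \<open>n\<close>.\<close>

lemma binomial_moment_bound:
  fixes x :: real
  assumes x: "0 < x" "x < 1" and k: "k \<ge> 1"
  shows "\<exists>C\<ge>0. \<forall>r n. (\<lambda>q. x ^ q * real ((r + k * q + n) choose n)) summable_on UNIV \<and>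
    (\<lambda>q. x ^ q * real ((r + k * q + n) choose n) * (1 + real q / (real n + 1)) ^ j) summable_on UNIV \<and>
    (\<Sum>\<^sub>\<infinity>q. x ^ q * real ((r + k * q + n) choose n) * (1 + real q / (real n + 1)) ^ j)
      \<le> C * (\<Sum>\<^sub>\<infinity>q. x ^ q * real ((r + k * q + n) choose n))"
proof -
  \<comment> \<open>A ratio strictly between \<open>x\<close> and 1: a large \<open>M\<close> makes
    the growth factor \<open>(1 + 1 / M) ^ k * x\<close> of one step in \<open>q\<close> smaller
    than \<open>\<rho>\<close>.\<close>
  define \<rho> where "\<rho> = (1 + x) / 2"
  have \<rho>: "0 < \<rho>" "\<rho> < 1" "x < \<rho>" using x by (auto simp: \<rho>_def)
  have "((\<lambda>M. (1 + 1 / real M) ^ k * x) \<longlongrightarrow> (1 + 0) ^ k * x) sequentially"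
    by (intro tendsto_intros)
  then have "eventually (\<lambda>M. (1 + 1 / real M) ^ k * x < \<rho>) sequentially"
    by (rule order_tendstoD) (use \<rho> in auto)
  from eventually_conj[OF this eventually_ge_at_top[of 1]]
  obtain M where M: "(1 + 1 / real M) ^ k * x < \<rho>" "M \<ge> 1"
    by (auto simp: eventually_sequentially)
  define C' where "C' = (\<Sum>i. \<rho> ^ i * (1 + real M + real i) ^ j)"
  have sumC': "summable (\<lambda>i. \<rho> ^ i * (1 + real M + real i) ^ j)"
    using summable_poly_times_geometric[of \<rho> "1 + real M" j] \<rho> by simp
  have C': "C' \<ge> 0" unfolding C'_def using sumC' \<rho> by (intro suminf_nonneg) auto
  have main: "summable w \<and> summable g \<and> suminf g \<le> ((1 + real M) ^ j + C') * suminf w"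
    if w: "w = (\<lambda>q. x ^ q * real ((r + k * q + n) choose n))"
      and g: "g = (\<lambda>q. w q * (1 + real q / (real n + 1)) ^ j)" for r n w g
  proof -
    \<comment> \<open>From \<open>Q\<close> on, consecutive weights have ratio at most
      \<open>\<rho>\<close>. As \<open>Q\<close> is \<open>M\<close> times \<open>n + 1\<close>, the
      moment factor at \<open>i + Q\<close> is at most \<open>(1 + M + i) ^ j\<close>, and below
      \<open>Q\<close> it is at most \<open>(1 + M) ^ j\<close>; both bounds are free of
      \<open>n\<close> and \<open>r\<close>.\<close>
    define Q where "Q = M * (n + 1)"
    have w_nn: "w q \<ge> 0" for q using x by (simp add: w)
    have g_nn: "g q \<ge> 0" for q using w_nn by (simp add: g)
    have step: "w (Suc q) \<le> \<rho> * w q" if "q \<ge> Q" for q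
    proof -
      have "M * n \<le> q" using that by (simp add: Q_def)
      also have "q \<le> r + k * q" using k by (simp add: trans_le_add2)
      finally have "real ((r + k * q + k + n) choose n) \<le> (1 + 1 / real M) ^ k * real ((r + k * q + n) choose n)"
        by (rule binomial_growth[OF M(2)])
      then have "w (Suc q) \<le> x ^ q * x * ((1 + 1 / real M) ^ k * real ((r + k * q + n) choose n))"
        using x by (simp add: w algebra_simps mult_left_mono)
      also have "\<dots> = ((1 + 1 / real M) ^ k * x) * w q" by (simp add: w)
      also have "\<dots> \<le> \<rho> * w q" using M w_nn by (intro mult_right_mono) auto
      finally show ?thesis .
    qed
    have tail: "w (i + Q) \<le> \<rho> ^ i * w Q" for i
    proof (induction i)
      case (Suc i)
      have "w (Suc i + Q) \<le> \<rho> * w (i + Q)" using step[of "i + Q"] by simp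
      also have "\<dots> \<le> \<rho> * (\<rho> ^ i * w Q)" using Suc \<rho> by (intro mult_left_mono) auto
      finally show ?case by simp
    qed auto
    have ratio: "real (i + Q) / (real n + 1) \<le> real M + real i" for i
    proof -
      have "real i \<le> real i * (real n + 1)" by (simp add: mult_left_mono algebra_simps)
      then show ?thesis by (simp add: Q_def field_simps)
    qed
    have gtail: "g (i + Q) \<le> w Q * (\<rho> ^ i * (1 + real M + real i) ^ j)" for i
    proof -
      have "g (i + Q) \<le> (\<rho> ^ i * w Q) * (1 + real M + real i) ^ j"
        unfolding g using tail[of i] ratio[of i] w_nn \<rho>
        by (intro mult_mono power_mono) (auto simp: add.assoc intro!: add_nonneg_nonneg)
      then show ?thesis by (simp add: mult_ac)
    qed
    have "summable (\<lambda>i. w (i + Q))"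
      by (rule summable_comparison_test'[where g = "\<lambda>i. \<rho> ^ i * w Q" and N = 0])
         (use \<rho> tail w_nn in \<open>auto intro!: summable_mult2 summable_geometric\<close>)
    then have sw: "summable w" by (simp add: summable_iff_shift)
    have sgt: "summable (\<lambda>i. g (i + Q))"
      by (rule summable_comparison_test'[where g = "\<lambda>i. w Q * (\<rho> ^ i * (1 + real M + real i) ^ j)" and N = 0])
         (use gtail g_nn sumC' in \<open>auto intro!: summable_mult\<close>)
    then have sg: "summable g" by (simp add: summable_iff_shift)
    have "(\<Sum>i. g (i + Q)) \<le> (\<Sum>i. w Q * (\<rho> ^ i * (1 + real M + real i) ^ j))"
      by (intro suminf_le gtail sgt summable_mult sumC')
    also have "\<dots> = C' * w Q" using sumC' by (simp add: C'_def suminf_mult)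
    also have "w Q \<le> suminf w"
      using sum_le_suminf[OF sw, of "{Q}"] w_nn by auto
    finally have g1: "(\<Sum>i. g (i + Q)) \<le> C' * suminf w"
      using C' by (simp add: mult_left_mono)
    have "sum g {..<Q} \<le> (\<Sum>q<Q. (1 + real M) ^ j * w q)"
    proof (rule sum_mono)
      fix q assume "q \<in> {..<Q}"
      then have "real q / (real n + 1) \<le> real Q / (real n + 1)" by (intro divide_right_mono) auto
      also have "\<dots> \<le> real M" using ratio[of 0] by simp
      finally show "g q \<le> (1 + real M) ^ j * w q"
        unfolding g using w_nn by (subst mult.commute, intro mult_right_mono power_mono) auto
    qed
    also have "\<dots> = (1 + real M) ^ j * sum w {..<Q}" by (simp add: sum_distrib_left)
    also have "\<dots> \<le> (1 + real M) ^ j * suminf w"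
      using sum_le_suminf[OF sw, of "{..<Q}"] w_nn by (intro mult_left_mono) auto
    finally have "suminf g \<le> ((1 + real M) ^ j + C') * suminf w"
      using g1 suminf_split_initial_segment[OF sg, of Q] by (simp add: algebra_simps)
    with sw sg show ?thesis by blast
  qed
  \<comment> \<open>The estimates above use \<open>suminf\<close>; for nonnegative terms the ordered
    and the unordered sum agree.\<close>
  have conv: "f summable_on UNIV \<and> infsum f UNIV = suminf f" if "summable f" "\<And>q. f q \<ge> 0"
    for f :: "nat \<Rightarrow> real"
    using sums_nonneg_imp_has_sum[of f "suminf f"] that by (auto simp: has_sum_iff summable_sums)
  show ?thesis
  proof (intro exI[of _ "(1 + real M) ^ j + C'"] conjI allI)
    fix r n
    let ?w = "\<lambda>q. x ^ q * real ((r + k * q + n) choose n)"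
    let ?g = "\<lambda>q. x ^ q * real ((r + k * q + n) choose n) * (1 + real q / (real n + 1)) ^ j"
    note m = main[of ?w r n ?g, OF refl refl]
    have cw: "?w summable_on UNIV \<and> infsum ?w UNIV = suminf ?w"
      using m x by (intro conv) auto
    have cg: "?g summable_on UNIV \<and> infsum ?g UNIV = suminf ?g"
      using m x by (intro conv) auto
    show "?w summable_on UNIV" "?g summable_on UNIV"
      using cw cg by auto
    show "infsum ?g UNIV \<le> ((1 + real M) ^ j + C') * infsum ?w UNIV"
      using m cw cg by simp
  qed (use C' in auto)
qed

text \<open>First-order Taylor remainder; the exponent is purely imaginary, so no exponential growth
  enters the bound.\<close>

lemma exp_i_remainder: "cmod (exp (\<i> * of_real y) - 1 - \<i> * of_real y) \<le> y\<^sup>2"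
  using Taylor_exp[of "\<i> * of_real y" 1] by (simp add: norm_mult power2_eq_square diff_diff_eq)

text \<open>The left side is a single term of the binomial expansion of the right side.\<close>

lemma binomial_weight_le:
  assumes "0 \<le> a" "0 \<le> b"
  shows "real ((m + n) choose n) * (a ^ m)\<^sup>2 * (b ^ n)\<^sup>2 \<le> (a\<^sup>2 + b\<^sup>2) ^ (m + n)"
proof -
  have "real ((m + n) choose m) * (a\<^sup>2) ^ m * (b\<^sup>2) ^ (m + n - m) \<le>
      (\<Sum>i\<le>m + n. real ((m + n) choose i) * (a\<^sup>2) ^ i * (b\<^sup>2) ^ (m + n - i))"
    by (rule member_le_sum) auto
  also have "\<dots> = (a\<^sup>2 + b\<^sup>2) ^ (m + n)" by (simp add: binomial_ring)
  finally show ?thesis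
    using binomial_symmetric[of n "m + n"] by (simp add: power_mult[symmetric] mult.commute)
qed

section \<open>Besov weights compared with the Drury-Arveson weight\<close>

lemma besov_weight_DA: "besov_weight (-2) m n = 1 / real ((m + n) choose n)"
proof -
  have "Gamma (real m + real n + 1) = fact (m + n)"
    using Gamma_fact[of "m + n", where 'a = real] by (simp add: add_ac)
  then show ?thesis
    by (simp add: besov_weight_def binomial_fact field_simps)
qed

lemma fact_add_ge: "fact N * (real N + 1) ^ j \<le> fact (N + j)"
proof (induction j)
  case (Suc j)
  have "fact N * (real N + 1) ^ Suc j = (real N + 1) * (fact N * (real N + 1) ^ j)" by simp
  also have "\<dots> \<le> (real N + real j + 1) * fact (N + j)"
    using Suc by (intro mult_mono) auto
  finally show ?case by (simp add: algebra_simps)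
qed auto

text \<open>The quotient of Gamma values is \<open>pochhammer (s + 3) N\<close>, which increases
  with \<open>s\<close>. Comparison with the integer case \<open>s + 2 = j\<close>, where it equals
  \<open>fact (N + j) / fact j\<close>, yields a gain of \<open>(N + 1) ^ j\<close> over the
  Drury-Arveson weight.\<close>

lemma besov_weight_bounds:
  assumes "s + 2 \<ge> real j"
  shows "besov_weight s m n > 0"
    and "besov_weight s m n \<le> fact j / (real ((m + n) choose n) * (real (m + n) + 1) ^ j)"
proof -
  define N where "N = m + n"
  have "s + 3 > 0" using assms by linarith
  then have G: "Gamma (s + 3) > 0" "Gamma (real N + s + 3) > 0" by (auto intro!: Gamma_real_pos)
  have eq: "besov_weight s m n = fact m * fact n * Gamma (s + 3) / Gamma (real N + s + 3)"
    by (simp add: besov_weight_def N_def add_ac)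
  show "besov_weight s m n > 0" unfolding eq using G by simp
  have "s + 3 \<notin> \<int>\<^sub>\<le>\<^sub>0" using \<open>s + 3 > 0\<close> by (auto elim!: nonpos_Ints_cases)
  from pochhammer_Gamma[OF this, of N]
  have poch: "Gamma (real N + s + 3) = pochhammer (s + 3) N * Gamma (s + 3)"
    using G by (simp add: field_simps)
  have "fact (N + j) = fact j * pochhammer (real j + 1) N"
    using pochhammer_product'[of "1::real" j N]
    by (simp add: pochhammer_fact add_ac)
  moreover have "pochhammer (real j + 1) N \<le> pochhammer (s + 3) N"
    unfolding pochhammer_prod using assms by (intro prod_mono) auto
  ultimately have "fact N * (real N + 1) ^ j \<le> fact j * pochhammer (s + 3) N"
    using fact_add_ge[of N j] by (smt (verit) fact_gt_zero mult_left_mono)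
  moreover have "pochhammer (s + 3) N > 0" using \<open>s + 3 > 0\<close> by (rule pochhammer_pos)
  ultimately have "1 / pochhammer (s + 3) N \<le> fact j / (fact N * (real N + 1) ^ j)"
    by (simp add: divide_simps mult_ac)
  then have "fact m * fact n * (1 / pochhammer (s + 3) N) \<le> fact m * fact n * (fact j / (fact N * (real N + 1) ^ j))"
    by (intro mult_left_mono) auto
  moreover have binom: "real ((m + n) choose n) = fact N / (fact m * fact n)"
    by (simp add: binomial_fact N_def mult.commute)
  ultimately show "besov_weight s m n \<le> fact j / (real ((m + n) choose n) * (real (m + n) + 1) ^ j)"
    unfolding eq poch binom using G by (simp add: N_def mult_ac)
qed

section \<open>Operators given by symbols\<close>

lemma infsum_complex_of_real: "(\<Sum>\<^sub>\<infinity>x\<in>A. complex_of_real (f x)) = of_real (infsum f A)"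
proof (cases "f summable_on A")
  case True
  then show ?thesis by (intro infsumI has_sum_of_real) simp
next
  \<comment> \<open>If the real family is not summable, neither is its complex image, and both sums
    take the default value 0.\<close>
  case False
  then have "\<not> (\<lambda>x. complex_of_real (f x)) summable_on A"
    using summable_on_Re[of "\<lambda>x. complex_of_real (f x)" A] by auto
  with False show ?thesis by (simp add: infsum_not_exists)
qed

section \<open>Norms and linear structure in terms of coefficients\<close>

lemma besov_norm_eq:
  "besov_norm s f = sqrt (\<Sum>\<^sub>\<infinity>(m, n). (cmod (taylor_coeff f m n))\<^sup>2 * besov_weight s m n)"
proof -
  have "besov_inner s f f =
      (\<Sum>\<^sub>\<infinity>x. complex_of_real ((\<lambda>(m, n). (cmod (taylor_coeff f m n))\<^sup>2 * besov_weight s m n) x))"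
    unfolding besov_inner_def
    by (intro infsum_cong) (auto simp: complex_norm_square simp del: of_real_power)
  then show ?thesis by (simp add: besov_norm_def infsum_complex_of_real)
qed

lemma besov_norm_nonneg: "s \<ge> -2 \<Longrightarrow> besov_norm s f \<ge> 0"
  unfolding besov_norm_eq using besov_weight_bounds(1)[of 0 s]
  by (intro real_sqrt_ge_zero infsum_nonneg) (auto simp: less_imp_le)

text \<open>Stated for arrays instead of functions because the operators are first defined on
  coefficient arrays.\<close>

definition DA_summable :: "(nat \<Rightarrow> nat \<Rightarrow> complex) \<Rightarrow> bool" where
  "DA_summable a \<longleftrightarrow> (\<lambda>(m, n). (cmod (a m n))\<^sup>2 / real ((m + n) choose n)) summable_on UNIV"

lemma besov_DA_iff: "f \<in> besov (-2) \<longleftrightarrow> f \<in> analytic_ball \<and> DA_summable (taylor_coeff f)"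
  by (simp add: besov_def DA_summable_def besov_weight_DA)

lemma besov_DA_D: "f \<in> besov (-2) \<Longrightarrow> f \<in> analytic_ball" "f \<in> besov (-2) \<Longrightarrow> DA_summable (taylor_coeff f)"
  by (simp_all add: besov_DA_iff)

lemma norm_DA_eq:
  "besov_norm (-2) f = sqrt (\<Sum>\<^sub>\<infinity>(m, n). (cmod (taylor_coeff f m n))\<^sup>2 / real ((m + n) choose n))"
  by (simp add: besov_norm_eq besov_weight_DA)

text \<open>Ensures that the series of the inner product converges; a product of moduli is at most
  the sum of their squares.\<close>

lemma DA_summable_mult:
  assumes "DA_summable a" "DA_summable b"
  shows "(\<lambda>(m, n). a m n * cnj (b m n) / of_nat ((m + n) choose n)) summable_on UNIV"
proof (rule abs_summable_summable, rule summable_on_comparison_test)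
  show "(\<lambda>x. (case x of (m, n) \<Rightarrow> (cmod (a m n))\<^sup>2 / real ((m + n) choose n)) +
      (case x of (m, n) \<Rightarrow> (cmod (b m n))\<^sup>2 / real ((m + n) choose n))) summable_on UNIV"
    using assms unfolding DA_summable_def by (rule summable_on_add)
  fix x :: "nat \<times> nat"
  obtain m n where x: "x = (m, n)" by (cases x)
  have "cmod (a m n) * cmod (b m n) \<le> (cmod (a m n))\<^sup>2 + (cmod (b m n))\<^sup>2"
    using sum_squares_bound[of "cmod (a m n)" "cmod (b m n)"]
      mult_nonneg_nonneg[OF norm_ge_zero[of "a m n"] norm_ge_zero[of "b m n"]] by linarith
  then show "cmod (case x of (m, n) \<Rightarrow> a m n * cnj (b m n) / of_nat ((m + n) choose n)) \<le>
      (case x of (m, n) \<Rightarrow> (cmod (a m n))\<^sup>2 / real ((m + n) choose n)) +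
      (case x of (m, n) \<Rightarrow> (cmod (b m n))\<^sup>2 / real ((m + n) choose n))"
    by (simp add: x norm_mult norm_divide divide_right_mono flip: add_divide_distrib)
qed auto

lemma DA_summable_lincomb:
  assumes "DA_summable a" "DA_summable b"
  shows "DA_summable (\<lambda>m n. u * a m n + v * b m n)"
  unfolding DA_summable_def
proof (rule summable_on_comparison_test)
  show "(\<lambda>x. 2 * (cmod u)\<^sup>2 * (case x of (m, n) \<Rightarrow> (cmod (a m n))\<^sup>2 / real ((m + n) choose n)) +
      2 * (cmod v)\<^sup>2 * (case x of (m, n) \<Rightarrow> (cmod (b m n))\<^sup>2 / real ((m + n) choose n))) summable_on UNIV"
    using assms unfolding DA_summable_def by (intro summable_on_add summable_on_cmult_right)
  fix x :: "nat \<times> nat"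
  obtain m n where x: "x = (m, n)" by (cases x)
  have "(cmod (u * a m n + v * b m n))\<^sup>2 \<le> (cmod u * cmod (a m n) + cmod v * cmod (b m n))\<^sup>2"
    by (intro power_mono) (auto simp flip: norm_mult intro: norm_triangle_ineq)
  also have "\<dots> \<le> 2 * (cmod u * cmod (a m n))\<^sup>2 + 2 * (cmod v * cmod (b m n))\<^sup>2"
    using sum_squares_bound[of "cmod u * cmod (a m n)" "cmod v * cmod (b m n)"]
    by (simp add: power2_sum)
  finally have "(cmod (u * a m n + v * b m n))\<^sup>2 / real ((m + n) choose n) \<le>
      (2 * (cmod u * cmod (a m n))\<^sup>2 + 2 * (cmod v * cmod (b m n))\<^sup>2) / real ((m + n) choose n)"
    by (rule divide_right_mono) auto
  then show "(case x of (m, n) \<Rightarrow> (cmod (u * a m n + v * b m n))\<^sup>2 / real ((m + n) choose n)) \<le>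
      2 * (cmod u)\<^sup>2 * (case x of (m, n) \<Rightarrow> (cmod (a m n))\<^sup>2 / real ((m + n) choose n)) +
      2 * (cmod v)\<^sup>2 * (case x of (m, n) \<Rightarrow> (cmod (b m n))\<^sup>2 / real ((m + n) choose n))"
    by (simp add: x power_mult_distrib add_divide_distrib mult.assoc)
qed auto

lemma besov_DA_lincomb:
  assumes "f \<in> besov (-2)" "g \<in> besov (-2)"
  shows "(\<lambda>z. u * f z + v * g z) \<in> besov (-2)"
  using assms analytic_ball_lincomb[of f g] DA_summable_lincomb by (simp add: besov_DA_iff)

lemma besov_zero: "(\<lambda>_. 0) \<in> besov s"
  by (simp add: besov_def analytic_ball_zero case_prod_unfold)

text \<open>Makes every array in the range of the operators below the Taylor array of an analytic
  function. Summability bounds each \<open>c m n\<close> by the root of its weight; the binomial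
  coefficient is absorbed by \<open>\<tau> ^ (m + n)\<close>, and geometric decay beats the
  polynomial factor.\<close>

lemma weighted_summable_imp_ball_summable:
  assumes summ: "(\<lambda>(m, n). (cmod (c m n))\<^sup>2 / real ((m + n) choose n) / (real (m + n) + 1) ^ (2 * K)) summable_on UNIV"
    and z: "(z1, z2) \<in> ball 0 1"
  shows "(\<lambda>(m, n). c m n * z1 ^ m * z2 ^ n) summable_on UNIV"
proof -
  define \<tau> where "\<tau> = (cmod z1)\<^sup>2 + (cmod z2)\<^sup>2"
  have \<tau>: "0 \<le> \<tau>" "\<tau> < 1" using z unfolding in_unit_ball_iff \<tau>_def by auto
  \<comment> \<open>Taking a midpoint keeps \<open>\<rho>\<close> positive even at the origin, as
    the geometric comparison requires.\<close>
  obtain \<rho> where \<rho>: "0 < \<rho>" "\<rho> < 1" "sqrt \<tau> \<le> \<rho>"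
  proof -
    have mid: "\<exists>\<rho>. 0 < \<rho> \<and> \<rho> < 1 \<and> x \<le> \<rho>" if "0 \<le> x" "x < 1" for x :: real
      using that by (intro exI[of _ "(x + 1) / 2"]) auto
    show ?thesis using mid[of "sqrt \<tau>"] \<tau> that by auto
  qed
  have \<tau>\<rho>: "\<tau> \<le> \<rho>\<^sup>2" using \<rho>(3) \<tau> by (metis real_sqrt_ge_zero real_sqrt_pow2 power_mono)
  define D where "D = (\<Sum>\<^sub>\<infinity>(m, n). (cmod (c m n))\<^sup>2 / real ((m + n) choose n) / (real (m + n) + 1) ^ (2 * K))"
  define \<beta> where "\<beta> i = \<rho> ^ i * (1 + real i) ^ K" for i
  have \<beta>_nn: "\<beta> i \<ge> 0" for i using \<rho> by (simp add: \<beta>_def)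
  have "summable \<beta>" unfolding \<beta>_def using \<rho> by (intro summable_poly_times_geometric) auto
  then have \<beta>: "\<beta> summable_on UNIV" using \<beta>_nn by (simp add: summable_on_UNIV_nonneg_real_iff)
  have "(\<lambda>(m, n). \<beta> m * \<beta> n) summable_on UNIV \<times> UNIV"
  proof (rule summable_on_SigmaI)
    show "((\<lambda>n. (case (m, n) of (m, n) \<Rightarrow> \<beta> m * \<beta> n)) has_sum \<beta> m * infsum \<beta> UNIV) UNIV" for m
      using \<beta> by (simp add: has_sum_cmult_right)
    show "(\<lambda>m. \<beta> m * infsum \<beta> UNIV) summable_on UNIV" using \<beta> by (rule summable_on_cmult_left)
  qed (use \<beta>_nn in auto)
  then have maj: "(\<lambda>(m, n). sqrt D * (\<beta> m * \<beta> n)) summable_on UNIV"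
    using summable_on_cmult_right[of _ UNIV "sqrt D"] by (simp add: case_prod_unfold)
  have bound: "cmod (c m n * z1 ^ m * z2 ^ n) \<le> sqrt D * (\<beta> m * \<beta> n)" for m n
  proof -
    let ?b = "real ((m + n) choose n)" and ?N = "(real (m + n) + 1)"
    have "(cmod (c m n))\<^sup>2 / ?b / ?N ^ (2 * K) \<le> D"
      using finite_sum_le_infsum[OF summ, of "{(m, n)}"] by (auto simp: D_def)
    then have "(cmod (c m n))\<^sup>2 \<le> D * ?b * ?N ^ (2 * K)"
      by (simp add: divide_simps mult_ac)
    then have "(cmod (c m n))\<^sup>2 * ((cmod z1 ^ m)\<^sup>2 * (cmod z2 ^ n)\<^sup>2)
        \<le> (D * ?b * ?N ^ (2 * K)) * ((cmod z1 ^ m)\<^sup>2 * (cmod z2 ^ n)\<^sup>2)"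
      by (rule mult_right_mono) auto
    also have "\<dots> = D * ?N ^ (2 * K) * (?b * (cmod z1 ^ m)\<^sup>2 * (cmod z2 ^ n)\<^sup>2)" by (simp add: mult_ac)
    also have "\<dots> \<le> D * ?N ^ (2 * K) * \<tau> ^ (m + n)"
      unfolding \<tau>_def D_def by (intro mult_left_mono binomial_weight_le mult_nonneg_nonneg infsum_nonneg) auto
    also have "\<dots> \<le> D * ?N ^ (2 * K) * (\<rho>\<^sup>2) ^ (m + n)"
      unfolding D_def by (intro mult_left_mono power_mono \<tau>\<rho> \<tau> mult_nonneg_nonneg infsum_nonneg) auto
    \<comment> \<open>Since \<open>1 + m + n \<le> (1 + m) * (1 + n)\<close>, the majorant splits
      into a product of two one-variable sequences.\<close>
    also have "\<dots> \<le> D * ((1 + real m) * (1 + real n)) ^ (2 * K) * (\<rho>\<^sup>2) ^ (m + n)"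
      unfolding D_def
      by (intro mult_right_mono mult_left_mono power_mono mult_nonneg_nonneg infsum_nonneg) (auto simp: algebra_simps)
    also have "\<dots> = D * (\<beta> m * \<beta> n)\<^sup>2"
      by (simp add: \<beta>_def power_mult_distrib power_add mult_ac flip: power_mult)
    finally have "sqrt ((cmod (c m n * z1 ^ m * z2 ^ n))\<^sup>2) \<le> sqrt (D * (\<beta> m * \<beta> n)\<^sup>2)"
      by (intro real_sqrt_le_mono) (simp add: norm_mult norm_power power_mult_distrib mult_ac)
    then show ?thesis using \<beta>_nn by (simp add: real_sqrt_mult)
  qed
  show ?thesis
    by (rule abs_summable_summable, rule summable_on_comparison_test[OF maj]) (use bound in auto)
qed

section \<open>Lines of indices and matrix coefficients\<close>

locale ideal_params =
  fixes k :: nat and \<epsilon> :: real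
  assumes k: "k \<ge> 1" and \<epsilon>: "0 < \<epsilon>" "\<epsilon> < 1"
begin

text \<open>Division with remainder: \<open>(m, n)\<close> is the point number
  \<open>m div k\<close> on the line labelled \<open>(m mod k, n)\<close>.\<close>

lemma bij_blocks: "bij_betw (\<lambda>((r, n), p). (r + k * p, n)) (({..<k} \<times> UNIV) \<times> UNIV) (UNIV :: (nat \<times> nat) set)"
  by (rule bij_betwI[where g = "\<lambda>(m, n). ((m mod k, n), m div k)"]) (use k in auto)

lemma has_sum_blocks:
  "(f has_sum S) (UNIV :: (nat \<times> nat) set) \<longleftrightarrow>
     ((\<lambda>((r, n), p). f (r + k * p, n)) has_sum S) (({..<k} \<times> UNIV) \<times> UNIV)"
  using has_sum_reindex_bij_betw[OF bij_blocks, of f S] by (simp add: case_prod_unfold)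

text \<open>The squared norm of the spanning vector with index \<open>(r, n)\<close>.\<close>

definition energy :: "nat \<Rightarrow> nat \<Rightarrow> real" where
  "energy r n = (\<Sum>\<^sub>\<infinity>q. (\<epsilon>\<^sup>2) ^ q * real ((r + k * q + n) choose n))"

text \<open>One constant is fixed by choice from \<open>binomial_moment_bound\<close>, so that the
  same bound serves all \<open>r\<close> and \<open>n\<close>.\<close>

definition moment_const :: "nat \<Rightarrow> real" where
  "moment_const j = (SOME C. C \<ge> 0 \<and> (\<forall>r n. (\<lambda>q. (\<epsilon>\<^sup>2) ^ q * real ((r + k * q + n) choose n)) summable_on UNIV \<and>
    (\<lambda>q. (\<epsilon>\<^sup>2) ^ q * real ((r + k * q + n) choose n) * (1 + real q / (real n + 1)) ^ j) summable_on UNIV \<and>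
    (\<Sum>\<^sub>\<infinity>q. (\<epsilon>\<^sup>2) ^ q * real ((r + k * q + n) choose n) * (1 + real q / (real n + 1)) ^ j)
      \<le> C * (\<Sum>\<^sub>\<infinity>q. (\<epsilon>\<^sup>2) ^ q * real ((r + k * q + n) choose n))))"

lemma moment:
  shows "moment_const j \<ge> 0"
    and "(\<lambda>q. (\<epsilon>\<^sup>2) ^ q * real ((r + k * q + n) choose n)) summable_on UNIV"
    and "(\<lambda>q. (\<epsilon>\<^sup>2) ^ q * real ((r + k * q + n) choose n) * (1 + real q / (real n + 1)) ^ j) summable_on UNIV"
    and "(\<Sum>\<^sub>\<infinity>q. (\<epsilon>\<^sup>2) ^ q * real ((r + k * q + n) choose n) * (1 + real q / (real n + 1)) ^ j)
      \<le> moment_const j * energy r n"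
proof -
  have "0 < \<epsilon>\<^sup>2" "\<epsilon>\<^sup>2 < 1" using \<epsilon> by (auto simp: power_less_one_iff abs_square_less_1)
  from someI_ex[OF binomial_moment_bound[OF this k, of j, unfolded Bex_def], folded moment_const_def]
  show "moment_const j \<ge> 0"
    "(\<lambda>q. (\<epsilon>\<^sup>2) ^ q * real ((r + k * q + n) choose n)) summable_on UNIV"
    "(\<lambda>q. (\<epsilon>\<^sup>2) ^ q * real ((r + k * q + n) choose n) * (1 + real q / (real n + 1)) ^ j) summable_on UNIV"
    "(\<Sum>\<^sub>\<infinity>q. (\<epsilon>\<^sup>2) ^ q * real ((r + k * q + n) choose n) * (1 + real q / (real n + 1)) ^ j)
      \<le> moment_const j * energy r n"
    unfolding energy_def by blast+
qed

lemma energy_has_sum: "((\<lambda>q. (\<epsilon>\<^sup>2) ^ q * real ((r + k * q + n) choose n)) has_sum energy r n) UNIV"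
  using moment(2)[of r n] by (simp add: energy_def)

lemma energy_pos: "energy r n > 0"
proof -
  have "real ((r + n) choose n) \<le> energy r n"
    using finite_sum_le_has_sum[OF energy_has_sum, of "{0}" r n] by auto
  moreover have "real ((r + n) choose n) > 0" by simp
  ultimately show ?thesis by linarith
qed

text \<open>The projection \<open>P\<^sub>t\<close> has symbol \<open>\<phi> d = e\<^sup>i\<^sup>d\<^sup>t\<close>; a general symbol \<open>\<phi>\<close> multiplies the matrix
  entry of the projection at \<open>t = 0\<close> in row \<open>p\<close> and column \<open>q\<close> by \<open>\<phi> (q - p)\<close>.\<close>

definition op_coeff :: "(int \<Rightarrow> complex) \<Rightarrow> (nat \<Rightarrow> nat \<Rightarrow> complex) \<Rightarrow> nat \<Rightarrow> nat \<Rightarrow> complex" where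
  "op_coeff \<phi> a m n =
     of_real (\<epsilon> ^ (m div k) * real ((m + n) choose n) / energy (m mod k) n) *
     (\<Sum>\<^sub>\<infinity>q. \<phi> (int q - int (m div k)) * of_real (\<epsilon> ^ q) * a (m mod k + k * q) n)"

definition poly_bounded :: "real \<Rightarrow> nat \<Rightarrow> (int \<Rightarrow> complex) \<Rightarrow> bool" where
  "poly_bounded A K \<phi> \<longleftrightarrow> (\<forall>d. cmod (\<phi> d) \<le> A * (1 + \<bar>real_of_int d\<bar>) ^ K)"

text \<open>The squared Drury-Arveson norm of the part of \<open>a\<close> supported on the line
  \<open>(r, n)\<close>.\<close>

definition block_norm2 :: "(nat \<Rightarrow> nat \<Rightarrow> complex) \<Rightarrow> nat \<Rightarrow> nat \<Rightarrow> real" where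
  "block_norm2 a r n = (\<Sum>\<^sub>\<infinity>q. (cmod (a (r + k * q) n))\<^sup>2 / real ((r + k * q + n) choose n))"

lemma DA_summable_blocks:
  assumes "DA_summable a"
  shows "r < k \<Longrightarrow> ((\<lambda>q. (cmod (a (r + k * q) n))\<^sup>2 / real ((r + k * q + n) choose n)) has_sum block_norm2 a r n) UNIV"
    and "((\<lambda>(r, n). block_norm2 a r n) has_sum
           (\<Sum>\<^sub>\<infinity>(m, n). (cmod (a m n))\<^sup>2 / real ((m + n) choose n))) ({..<k} \<times> UNIV)"
proof -
  let ?S = "\<Sum>\<^sub>\<infinity>(m, n). (cmod (a m n))\<^sup>2 / real ((m + n) choose n)"
  have *: "((\<lambda>((r, n), p). (cmod (a (r + k * p) n))\<^sup>2 / real ((r + k * p + n) choose n)) has_sum ?S)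
      (({..<k} \<times> UNIV) \<times> UNIV)"
    using assms has_sum_blocks[of "\<lambda>(m, n). (cmod (a m n))\<^sup>2 / real ((m + n) choose n)" ?S]
    by (simp add: DA_summable_def)
  show 1: "((\<lambda>q. (cmod (a (r + k * q) n))\<^sup>2 / real ((r + k * q + n) choose n)) has_sum block_norm2 a r n) UNIV"
    if "r < k" for r n
    using summable_on_SigmaD1[of "\<lambda>(r, n) p. (cmod (a (r + k * p) n))\<^sup>2 / real ((r + k * p + n) choose n)"
      "{..<k} \<times> UNIV" "\<lambda>_. UNIV" "(r, n)"] has_sum_imp_summable[OF *] that
    by (simp add: block_norm2_def case_prod_unfold)
  show "((\<lambda>(r, n). block_norm2 a r n) has_sum ?S) ({..<k} \<times> UNIV)"
    by (rule has_sum_SigmaD[OF *]) (use 1 in auto)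
qed

text \<open>Cauchy-Schwarz along one line: the symbol is paired with a moment of the energy, and the
  array with its norm on the line. The growth of the symbol in the row index costs the factor
  \<open>(m + n + 1) ^ (2 * K)\<close> on the squared modulus.\<close>

lemma op_coeff_row:
  assumes a: "DA_summable a" and \<phi>: "poly_bounded A K \<phi>"
  shows "(\<lambda>q. cmod (\<phi> (int q - int (m div k)) * of_real (\<epsilon> ^ q) * a (m mod k + k * q) n)) summable_on UNIV"
    and "(cmod (op_coeff \<phi> a m n))\<^sup>2 / real ((m + n) choose n) / (real (m + n) + 1) ^ (2 * K) \<le>
      A\<^sup>2 * moment_const (2 * K) * block_norm2 a (m mod k) n / energy (m mod k) n *
        ((\<epsilon>\<^sup>2) ^ (m div k) * real ((m + n) choose n))"
proof -
  define p where "p = m div k"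
  define r where "r = m mod k"
  have r: "r < k" using k by (simp add: r_def)
  have "m = r + k * p" by (simp add: r_def p_def)
  then have pm: "p \<le> m" using k by (simp add: trans_le_add2)
  define u where "u q = real ((r + k * q + n) choose n)" for q
  have u: "u q > 0" for q by (simp add: u_def)
  define N where "N = real (m + n) + 1"
  \<comment> \<open>The factor \<open>sqrt (u q)\<close> is moved from \<open>Y\<close> to
    \<open>X\<close>, so that the squares of \<open>Y\<close> sum to \<open>block_norm2\<close> and
    those of \<open>X\<close> are bounded by energy moments.\<close>
  define X where "X q = cmod (\<phi> (int q - int p)) * \<epsilon> ^ q * sqrt (u q)" for q
  define Y where "Y q = cmod (a (r + k * q) n) / sqrt (u q)" for q
  define S where "S = (\<Sum>\<^sub>\<infinity>q. \<phi> (int q - int p) * of_real (\<epsilon> ^ q) * a (r + k * q) n)"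
  let ?C = "moment_const (2 * K)" and ?E = "energy r n" and ?B = "block_norm2 a r n"
  have Apos: "A \<ge> 0" using \<phi>[unfolded poly_bounded_def, rule_format, of 0] norm_ge_zero[of "\<phi> 0"]
    by (simp del: norm_ge_zero)
  have Xle: "(X q)\<^sup>2 \<le> (A\<^sup>2 * N ^ (2 * K)) * ((\<epsilon>\<^sup>2) ^ q * u q * (1 + real q / (real n + 1)) ^ (2 * K))" for q
  proof -
    \<comment> \<open>Row and column are separated here: the row part \<open>p + n + 1\<close> is at
      most \<open>N\<close>, and the column part \<open>1 + q / (n + 1)\<close> is the factor
      occurring in the moments.\<close>
    have "1 + \<bar>real_of_int (int q - int p)\<bar> \<le> 1 + real p + real q" by simp
    also have "\<dots> \<le> (real (p + n) + 1) * (1 + real q / (real n + 1))"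
      by (simp add: field_simps)
    also have "\<dots> \<le> N * (1 + real q / (real n + 1))"
      using pm unfolding N_def by (intro mult_right_mono) auto
    finally have "A * (1 + \<bar>real_of_int (int q - int p)\<bar>) ^ K \<le> A * (N * (1 + real q / (real n + 1))) ^ K"
      using Apos by (intro mult_left_mono power_mono) auto
    then have "cmod (\<phi> (int q - int p)) \<le> A * (N * (1 + real q / (real n + 1))) ^ K"
      using \<phi> unfolding poly_bounded_def by (meson order_trans)
    then have "(cmod (\<phi> (int q - int p)))\<^sup>2 \<le> (A * (N * (1 + real q / (real n + 1))) ^ K)\<^sup>2"
      by (intro power_mono) auto
    then have "(cmod (\<phi> (int q - int p)))\<^sup>2 * ((\<epsilon> ^ q)\<^sup>2 * u q) \<le>
        (A * (N * (1 + real q / (real n + 1))) ^ K)\<^sup>2 * ((\<epsilon> ^ q)\<^sup>2 * u q)"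
      using u[of q] by (intro mult_right_mono) auto
    moreover have "(X q)\<^sup>2 = (cmod (\<phi> (int q - int p)))\<^sup>2 * ((\<epsilon> ^ q)\<^sup>2 * u q)"
      using u[of q] by (simp add: X_def power_mult_distrib)
    moreover have "(A * (N * (1 + real q / (real n + 1))) ^ K)\<^sup>2 * ((\<epsilon> ^ q)\<^sup>2 * u q) =
        (A\<^sup>2 * N ^ (2 * K)) * ((\<epsilon>\<^sup>2) ^ q * u q * (1 + real q / (real n + 1)) ^ (2 * K))"
      by (simp add: power_mult_distrib mult_ac flip: power_mult)
    ultimately show ?thesis by simp
  qed
  have maj: "(\<lambda>q. (A\<^sup>2 * N ^ (2 * K)) * ((\<epsilon>\<^sup>2) ^ q * u q * (1 + real q / (real n + 1)) ^ (2 * K))) summable_on UNIV"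
    unfolding u_def by (intro summable_on_cmult_right moment)
  have X: "(\<lambda>q. (X q)\<^sup>2) summable_on UNIV"
    by (rule summable_on_comparison_test[OF maj]) (use Xle in auto)
  have "(\<Sum>\<^sub>\<infinity>q. (X q)\<^sup>2) \<le> (\<Sum>\<^sub>\<infinity>q. (A\<^sup>2 * N ^ (2 * K)) * ((\<epsilon>\<^sup>2) ^ q * u q * (1 + real q / (real n + 1)) ^ (2 * K)))"
    by (intro infsum_mono X maj Xle)
  also have "\<dots> = (A\<^sup>2 * N ^ (2 * K)) * (\<Sum>\<^sub>\<infinity>q. (\<epsilon>\<^sup>2) ^ q * u q * (1 + real q / (real n + 1)) ^ (2 * K))"
    unfolding u_def by (intro infsum_cmult_right moment)
  also have "\<dots> \<le> (A\<^sup>2 * N ^ (2 * K)) * (?C * ?E)"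
    unfolding u_def by (intro mult_left_mono moment) (auto simp: N_def)
  finally have X2: "(\<Sum>\<^sub>\<infinity>q. (X q)\<^sup>2) \<le> (A\<^sup>2 * N ^ (2 * K)) * (?C * ?E)" .
  have Yeq: "(Y q)\<^sup>2 = (cmod (a (r + k * q) n))\<^sup>2 / real ((r + k * q + n) choose n)" for q
    using u[of q] by (simp add: Y_def power_divide) (simp add: u_def)
  have Y: "((\<lambda>q. (Y q)\<^sup>2) has_sum ?B) UNIV"
    unfolding Yeq by (rule DA_summable_blocks(1)[OF a r])
  have XY: "\<bar>X q * Y q\<bar> = cmod (\<phi> (int q - int p) * of_real (\<epsilon> ^ q) * a (r + k * q) n)" for q
    using u[of q] \<epsilon> by (simp add: X_def Y_def norm_mult norm_power abs_mult)
  note CS = Cauchy_Schwarz_infsum[OF X has_sum_imp_summable[OF Y], unfolded XY]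
  show "(\<lambda>q. cmod (\<phi> (int q - int (m div k)) * of_real (\<epsilon> ^ q) * a (m mod k + k * q) n)) summable_on UNIV"
    using CS(1) by (simp add: p_def r_def)
  have "(cmod S)\<^sup>2 \<le> (\<Sum>\<^sub>\<infinity>q. cmod (\<phi> (int q - int p) * of_real (\<epsilon> ^ q) * a (r + k * q) n))\<^sup>2"
    unfolding S_def by (intro power_mono norm_infsum_bound CS) auto
  also have "\<dots> \<le> (\<Sum>\<^sub>\<infinity>q. (X q)\<^sup>2) * ?B"
    using CS(2) Y by (simp add: has_sum_iff)
  also have "\<dots> \<le> ((A\<^sup>2 * N ^ (2 * K)) * (?C * ?E)) * ?B"
    by (intro mult_right_mono X2 has_sum_nonneg[OF Y]) auto
  finally have S: "(cmod S)\<^sup>2 \<le> ((A\<^sup>2 * N ^ (2 * K)) * (?C * ?E)) * ?B" .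
  have E: "?E > 0" by (rule energy_pos)
  have um: "real ((m + n) choose n) = u p" unfolding u_def using \<open>m = r + k * p\<close> by simp
  have "op_coeff \<phi> a m n = of_real (\<epsilon> ^ p * u p / ?E) * S"
    unfolding op_coeff_def p_def[symmetric] r_def[symmetric] S_def um ..
  then have "(cmod (op_coeff \<phi> a m n))\<^sup>2 = (\<epsilon> ^ p * u p / ?E)\<^sup>2 * (cmod S)\<^sup>2"
    by (simp only: norm_mult norm_of_real power_mult_distrib power2_abs)
  also have "\<dots> \<le> (\<epsilon> ^ p * u p / ?E)\<^sup>2 * (((A\<^sup>2 * N ^ (2 * K)) * (?C * ?E)) * ?B)"
    by (intro mult_left_mono S) auto
  \<comment> \<open>One of the two energies in the denominator cancels against the moment bound; the
    other one cancels when the rows of a line are summed.\<close>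
  also have "\<dots> = (A\<^sup>2 * ?C * ?B / ?E * ((\<epsilon>\<^sup>2) ^ p * u p)) * (u p * N ^ (2 * K))"
  proof -
    have alg: "(e * v / E)\<^sup>2 * (((x * M) * (c * E)) * b) = (x * c * b / E * (e\<^sup>2 * v)) * (v * M)"
      if "E \<noteq> 0" for e v E x M c b :: real
      using that by (simp add: field_simps power2_eq_square)
    have "(\<epsilon>\<^sup>2) ^ p = (\<epsilon> ^ p)\<^sup>2" by (simp flip: power_mult add: mult.commute)
    with alg[of ?E "\<epsilon> ^ p" "u p" "A\<^sup>2" "N ^ (2 * K)" ?C ?B] E show ?thesis by simp
  qed
  finally have "(cmod (op_coeff \<phi> a m n))\<^sup>2 / (u p * N ^ (2 * K)) \<le> A\<^sup>2 * ?C * ?B / ?E * ((\<epsilon>\<^sup>2) ^ p * u p)"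
    using u[of p] by (subst pos_divide_le_eq) (auto simp: N_def)
  then show "(cmod (op_coeff \<phi> a m n))\<^sup>2 / real ((m + n) choose n) / (real (m + n) + 1) ^ (2 * K) \<le>
      A\<^sup>2 * moment_const (2 * K) * block_norm2 a (m mod k) n / energy (m mod k) n *
        ((\<epsilon>\<^sup>2) ^ (m div k) * real ((m + n) choose n))"
    unfolding um p_def[symmetric] r_def[symmetric] N_def by simp
qed

text \<open>Summing the row bounds over \<open>p\<close> reproduces the energy and cancels the
  remaining denominator; the norms of the lines then add up to the full norm.\<close>

lemma op_coeff_bound:
  assumes a: "DA_summable a" and \<phi>: "poly_bounded A K \<phi>"
  defines "F \<equiv> (\<lambda>(m, n). (cmod (op_coeff \<phi> a m n))\<^sup>2 / real ((m + n) choose n) / (real (m + n) + 1) ^ (2 * K))"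
  shows "F summable_on UNIV"
    and "infsum F UNIV \<le> A\<^sup>2 * moment_const (2 * K) * (\<Sum>\<^sub>\<infinity>(m, n). (cmod (a m n))\<^sup>2 / real ((m + n) choose n))"
proof -
  let ?I = "{..<k} \<times> (UNIV :: nat set)"
  let ?C = "A\<^sup>2 * moment_const (2 * K)"
  let ?S = "\<Sum>\<^sub>\<infinity>(m, n). (cmod (a m n))\<^sup>2 / real ((m + n) choose n)"
  define G where "G = (\<lambda>((r, n), p). ?C * block_norm2 a r n / energy r n * ((\<epsilon>\<^sup>2) ^ p * real ((r + k * p + n) choose n)))"
  have inner: "((\<lambda>p. G (x, p)) has_sum (\<lambda>(r, n). ?C * block_norm2 a r n) x) UNIV" for x
    using has_sum_cmult_right[OF energy_has_sum[of "fst x" "snd x"],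
        of "?C * block_norm2 a (fst x) (snd x) / energy (fst x) (snd x)"]
      energy_pos[of "fst x" "snd x"]
    by (simp add: G_def case_prod_unfold)
  have outer: "((\<lambda>(r, n). ?C * block_norm2 a r n) has_sum ?C * ?S) ?I"
    using has_sum_cmult_right[OF DA_summable_blocks(2)[OF a], of ?C] by (simp add: case_prod_unfold)
  have summ: "G summable_on ?I \<times> UNIV"
  proof (rule summable_on_SigmaI[OF inner has_sum_imp_summable[OF outer]])
    fix x :: "nat \<times> nat" and p :: nat
    show "G (x, p) \<ge> 0"
      unfolding G_def using moment(1)[of "2 * K"] less_imp_le[OF energy_pos[of "fst x" "snd x"]]
      by (auto simp: case_prod_unfold block_norm2_def intro!: mult_nonneg_nonneg divide_nonneg_nonneg infsum_nonneg)
  qed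
  have G: "(G has_sum ?C * ?S) (?I \<times> UNIV)"
    by (rule has_sum_SigmaI[OF inner outer summ])
  define F' where "F' = (\<lambda>((r, n), p). F (r + k * p, n))"
  have le: "F' x \<le> G x" if "x \<in> ?I \<times> UNIV" for x
  proof -
    obtain r n p where x: "x = ((r, n), p)" by (metis prod.exhaust)
    with that have "r < k" by simp
    then show ?thesis
      using op_coeff_row(2)[OF a \<phi>, of "r + k * p" n] by (simp add: x F'_def F_def G_def)
  qed
  have F': "F' summable_on ?I \<times> UNIV"
    by (rule summable_on_comparison_test[OF has_sum_imp_summable[OF G] le]) (auto simp: F'_def F_def)
  then have "(F' has_sum infsum F' (?I \<times> UNIV)) (?I \<times> UNIV)" by simp
  then have F: "(F has_sum infsum F' (?I \<times> UNIV)) UNIV"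
    using has_sum_blocks[of F] by (simp add: F'_def)
  then show "F summable_on UNIV" by (rule has_sum_imp_summable)
  have "infsum F' (?I \<times> UNIV) \<le> ?C * ?S"
    by (rule has_sum_mono[OF has_sum_infsum[OF F'] G le])
  with F show "infsum F UNIV \<le> ?C * ?S" by (simp add: has_sum_iff)
qed

section \<open>Linearity in the symbol and in the argument\<close>

lemma poly_bounded_lincomb:
  assumes "poly_bounded A K \<phi>" "poly_bounded B K \<psi>"
  shows "poly_bounded (cmod u * A + cmod v * B) K (\<lambda>d. u * \<phi> d + v * \<psi> d)"
  unfolding poly_bounded_def
proof
  fix d
  have "cmod (u * \<phi> d + v * \<psi> d) \<le> cmod u * cmod (\<phi> d) + cmod v * cmod (\<psi> d)"
    by (metis norm_mult norm_triangle_ineq)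
  also have "\<dots> \<le> cmod u * (A * (1 + \<bar>real_of_int d\<bar>) ^ K) + cmod v * (B * (1 + \<bar>real_of_int d\<bar>) ^ K)"
    using assms unfolding poly_bounded_def by (intro add_mono mult_left_mono) auto
  finally show "cmod (u * \<phi> d + v * \<psi> d) \<le> (cmod u * A + cmod v * B) * (1 + \<bar>real_of_int d\<bar>) ^ K"
    by (simp add: algebra_simps)
qed

lemma op_coeff_row_summable:
  assumes "DA_summable a" "poly_bounded A K \<phi>"
  shows "(\<lambda>q. \<phi> (int q - int (m div k)) * of_real (\<epsilon> ^ q) * a (m mod k + k * q) n) summable_on UNIV"
  by (rule abs_summable_summable, rule op_coeff_row(1)[OF assms])

lemma op_coeff_lincomb_arg:
  assumes a: "DA_summable a" and b: "DA_summable b" and \<phi>: "poly_bounded A K \<phi>"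
  shows "op_coeff \<phi> (\<lambda>m n. u * a m n + v * b m n) m n = u * op_coeff \<phi> a m n + v * op_coeff \<phi> b m n"
proof -
  let ?s = "\<lambda>a q. \<phi> (int q - int (m div k)) * of_real (\<epsilon> ^ q) * a (m mod k + k * q) n"
  have "((\<lambda>q. u * ?s a q + v * ?s b q) has_sum (u * infsum (?s a) UNIV + v * infsum (?s b) UNIV)) UNIV"
    by (intro has_sum_add has_sum_cmult_right has_sum_infsum op_coeff_row_summable[OF a \<phi>] op_coeff_row_summable[OF b \<phi>])
  then have "infsum (?s (\<lambda>m n. u * a m n + v * b m n)) UNIV = u * infsum (?s a) UNIV + v * infsum (?s b) UNIV"
    by (intro infsumI) (simp add: algebra_simps)
  then show ?thesis by (simp add: op_coeff_def algebra_simps)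
qed

lemma op_coeff_lincomb_symbol:
  assumes a: "DA_summable a" and \<phi>: "poly_bounded A K \<phi>" and \<psi>: "poly_bounded B L \<psi>"
  shows "op_coeff (\<lambda>d. u * \<phi> d + v * \<psi> d) a m n = u * op_coeff \<phi> a m n + v * op_coeff \<psi> a m n"
proof -
  let ?s = "\<lambda>\<phi> q. \<phi> (int q - int (m div k)) * of_real (\<epsilon> ^ q) * a (m mod k + k * q) n"
  have "((\<lambda>q. u * ?s \<phi> q + v * ?s \<psi> q) has_sum (u * infsum (?s \<phi>) UNIV + v * infsum (?s \<psi>) UNIV)) UNIV"
    by (intro has_sum_add has_sum_cmult_right has_sum_infsum op_coeff_row_summable[OF a \<phi>] op_coeff_row_summable[OF a \<psi>])
  then have "infsum (?s (\<lambda>d. u * \<phi> d + v * \<psi> d)) UNIV = u * infsum (?s \<phi>) UNIV + v * infsum (?s \<psi>) UNIV"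
    by (intro infsumI) (simp add: algebra_simps)
  then show ?thesis by (simp add: op_coeff_def algebra_simps)
qed

text \<open>The value outside \<open>besov (-2)\<close> follows the convention of
  \<open>bounded_ops\<close>.\<close>

definition symbol_op :: "(int \<Rightarrow> complex) \<Rightarrow> ball_op" where
  "symbol_op \<phi> f = (if f \<in> besov (-2) then power_fun (op_coeff \<phi> (taylor_coeff f)) else (\<lambda>_. 0))"

lemma symbol_op_analytic:
  assumes "f \<in> besov (-2)" "poly_bounded A K \<phi>"
  shows "symbol_op \<phi> f \<in> analytic_ball" "taylor_coeff (symbol_op \<phi> f) = op_coeff \<phi> (taylor_coeff f)"
  using power_fun[OF weighted_summable_imp_ball_summable[OF
        op_coeff_bound(1)[OF besov_DA_D(2)[OF assms(1)] assms(2)]]] assms(1)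
  by (simp_all add: symbol_op_def)

lemma symbol_op_lincomb_arg:
  assumes f: "f \<in> besov (-2)" and g: "g \<in> besov (-2)" and \<phi>: "poly_bounded A K \<phi>"
  shows "symbol_op \<phi> (\<lambda>z. u * f z + v * g z) = (\<lambda>z. u * symbol_op \<phi> f z + v * symbol_op \<phi> g z)"
proof (rule analytic_ball_eqI)
  note fg = besov_DA_lincomb[OF f g, of u v]
  note an = symbol_op_analytic[OF f \<phi>] symbol_op_analytic[OF g \<phi>] symbol_op_analytic[OF fg \<phi>]
  show "symbol_op \<phi> (\<lambda>z. u * f z + v * g z) \<in> analytic_ball" by (rule an)
  show "(\<lambda>z. u * symbol_op \<phi> f z + v * symbol_op \<phi> g z) \<in> analytic_ball"
    by (intro analytic_ball_lincomb an)
  show "taylor_coeff (symbol_op \<phi> (\<lambda>z. u * f z + v * g z)) m n =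
      taylor_coeff (\<lambda>z. u * symbol_op \<phi> f z + v * symbol_op \<phi> g z) m n" for m n
    using f g by (simp add: an analytic_ball_lincomb besov_DA_D op_coeff_lincomb_arg[OF _ _ \<phi>])
qed

lemma symbol_op_lincomb_symbol:
  assumes f: "f \<in> besov (-2)" and \<phi>: "poly_bounded A K \<phi>" and \<psi>: "poly_bounded B K \<psi>"
  shows "symbol_op (\<lambda>d. u * \<phi> d + v * \<psi> d) f = (\<lambda>z. u * symbol_op \<phi> f z + v * symbol_op \<psi> f z)"
proof (rule analytic_ball_eqI)
  note an = symbol_op_analytic[OF f \<phi>] symbol_op_analytic[OF f \<psi>]
    symbol_op_analytic[OF f poly_bounded_lincomb[OF \<phi> \<psi>], of u v]
  show "symbol_op (\<lambda>d. u * \<phi> d + v * \<psi> d) f \<in> analytic_ball" by (rule an)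
  show "(\<lambda>z. u * symbol_op \<phi> f z + v * symbol_op \<psi> f z) \<in> analytic_ball"
    by (intro analytic_ball_lincomb an)
  show "taylor_coeff (symbol_op (\<lambda>d. u * \<phi> d + v * \<psi> d) f) m n =
      taylor_coeff (\<lambda>z. u * symbol_op \<phi> f z + v * symbol_op \<psi> f z) m n" for m n
    using f by (simp add: an analytic_ball_lincomb besov_DA_D op_coeff_lincomb_symbol[OF _ \<phi> \<psi>])
qed

text \<open>The factorial comes from comparing Besov weights with exponent \<open>2 * K\<close>, the
  moment constant from \<open>op_coeff_bound\<close>; the root passes from squared norms to
  norms.\<close>

definition op_const :: "nat \<Rightarrow> real" where
  "op_const K = sqrt (fact (2 * K) * moment_const (2 * K))"

lemma op_const_nonneg: "op_const K \<ge> 0"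
  by (simp add: op_const_def moment)

text \<open>The weight of \<open>besov s\<close> gains \<open>(m + n + 1) ^ (2 * K)\<close> when
  \<open>s + 2 \<ge> 2 * K\<close>, exactly what a symbol of growth \<open>K\<close> loses on
  squared norms.\<close>

lemma symbol_op_bound:
  assumes f: "f \<in> besov (-2)" and \<phi>: "poly_bounded A K \<phi>" and s: "s + 2 \<ge> 2 * real K"
  shows "symbol_op \<phi> f \<in> besov s"
    and "besov_norm s (symbol_op \<phi> f) \<le> op_const K * A * besov_norm (-2) f"
proof -
  have A: "A \<ge> 0"
    using order_trans[OF norm_ge_zero \<phi>[unfolded poly_bounded_def, rule_format, of 0]] by simp
  let ?a = "taylor_coeff f"
  let ?F = "\<lambda>(m, n). (cmod (op_coeff \<phi> ?a m n))\<^sup>2 / real ((m + n) choose n) / (real (m + n) + 1) ^ (2 * K)"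
  let ?G = "\<lambda>(m, n). (cmod (op_coeff \<phi> ?a m n))\<^sup>2 * besov_weight s m n"
  let ?S = "\<Sum>\<^sub>\<infinity>(m, n). (cmod (?a m n))\<^sup>2 / real ((m + n) choose n)"
  note F = op_coeff_bound[OF besov_DA_D(2)[OF f] \<phi>]
  have s': "s + 2 \<ge> real (2 * K)" using s by simp
  have le: "?G x \<le> fact (2 * K) * ?F x" and nn: "0 \<le> ?G x" for x
  proof -
    obtain m n where x: "x = (m, n)" by (cases x)
    have "(cmod (op_coeff \<phi> ?a m n))\<^sup>2 * besov_weight s m n \<le>
        (cmod (op_coeff \<phi> ?a m n))\<^sup>2 * (fact (2 * K) / (real ((m + n) choose n) * (real (m + n) + 1) ^ (2 * K)))"
      by (intro mult_left_mono besov_weight_bounds(2)[OF s']) auto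
    then show "?G x \<le> fact (2 * K) * ?F x" by (simp add: x mult_ac)
    show "0 \<le> ?G x" using besov_weight_bounds(1)[OF s', of m n] by (simp add: x)
  qed
  have Fs: "(\<lambda>x. fact (2 * K) * ?F x) summable_on UNIV" by (intro summable_on_cmult_right F)
  have G: "?G summable_on UNIV" by (rule summable_on_comparison_test[OF Fs le nn])
  with symbol_op_analytic[OF f \<phi>] show "symbol_op \<phi> f \<in> besov s" by (simp add: besov_def)
  have "infsum ?G UNIV \<le> (\<Sum>\<^sub>\<infinity>x. fact (2 * K) * ?F x)" by (intro infsum_mono G Fs le)
  also have "\<dots> = fact (2 * K) * infsum ?F UNIV" by (intro infsum_cmult_right F)
  also have "\<dots> \<le> fact (2 * K) * (A\<^sup>2 * moment_const (2 * K) * ?S)" by (intro mult_left_mono F) auto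
  finally have "sqrt (infsum ?G UNIV) \<le> sqrt (fact (2 * K) * moment_const (2 * K) * A\<^sup>2 * ?S)"
    by (intro real_sqrt_le_mono) (simp add: mult_ac)
  then show "besov_norm s (symbol_op \<phi> f) \<le> op_const K * A * besov_norm (-2) f"
    using A by (simp add: besov_norm_eq[of s] norm_DA_eq symbol_op_analytic[OF f \<phi>] op_const_def real_sqrt_mult)
qed

lemma symbol_op_in_bounded_ops:
  assumes \<phi>: "poly_bounded A K \<phi>" and s: "s + 2 \<ge> 2 * real K"
  shows "symbol_op \<phi> \<in> bounded_ops (-2) s"
  unfolding bounded_ops_def
proof (intro CollectI conjI allI ballI impI)
  show "\<exists>C. \<forall>f\<in>besov (- 2). besov_norm s (symbol_op \<phi> f) \<le> C * besov_norm (- 2) f"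
    using symbol_op_bound(2)[OF _ \<phi> s] by blast
  show "symbol_op \<phi> (\<lambda>z. f z + g z) = (\<lambda>z. symbol_op \<phi> f z + symbol_op \<phi> g z)"
    if "f \<in> besov (-2)" "g \<in> besov (-2)" for f g
    using symbol_op_lincomb_arg[OF that \<phi>, of 1 1] by simp
  show "symbol_op \<phi> (\<lambda>z. c * f z) = (\<lambda>z. c * symbol_op \<phi> f z)" if "f \<in> besov (-2)" for c f
    using symbol_op_lincomb_arg[OF that that \<phi>, of c 0] by simp
qed (use symbol_op_bound(1)[OF _ \<phi> s] in \<open>auto simp: symbol_op_def\<close>)

text \<open>Agreement of \<open>T\<close> with a symbol operator is asked only on the domain, so
  difference quotients can be inserted directly.\<close>

lemma op_norm_symbol_op:
  assumes T: "\<And>f. f \<in> besov (-2) \<Longrightarrow> T f = symbol_op \<phi> f"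
    and \<phi>: "poly_bounded A K \<phi>" and s: "s + 2 \<ge> 2 * real K"
  shows "0 \<le> op_norm (-2) s T" "op_norm (-2) s T \<le> op_const K * A"
proof -
  let ?B = "{f \<in> besov (-2). besov_norm (-2) f \<le> 1}"
  have A: "A \<ge> 0"
    using order_trans[OF norm_ge_zero \<phi>[unfolded poly_bounded_def, rule_format, of 0]] by simp
  \<comment> \<open>The supremum is taken over a nonempty set, and its lower bound 0 is read off at
    this element.\<close>
  have zero: "(\<lambda>_. 0) \<in> ?B"
    by (simp add: besov_zero norm_DA_eq analytic_ball_zero case_prod_unfold)
  have le: "besov_norm s (T f) \<le> op_const K * A" if "f \<in> ?B" for f
  proof -
    have "besov_norm s (T f) \<le> op_const K * A * besov_norm (-2) f"
      using symbol_op_bound(2)[OF _ \<phi> s] that by (simp add: T)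
    also have "\<dots> \<le> op_const K * A * 1"
      using that A op_const_nonneg by (intro mult_left_mono mult_nonneg_nonneg) auto
    finally show ?thesis by simp
  qed
  show "op_norm (-2) s T \<le> op_const K * A"
    unfolding op_norm_def by (rule cSUP_least) (use zero le in auto)
  have "0 \<le> besov_norm s (T (\<lambda>_. 0))"
    using s by (intro besov_norm_nonneg) (use of_nat_0_le_iff[of K, where 'a = real] in linarith)
  also have "\<dots> \<le> op_norm (-2) s T"
    unfolding op_norm_def by (rule cSUP_upper[OF zero]) (use le in \<open>auto simp: bdd_above_def\<close>)
  finally show "0 \<le> op_norm (-2) s T" .
qed

section \<open>Phase symbols and their derivatives\<close>

text \<open>The \<open>l\<close>-th derivative in \<open>t\<close> of
  \<open>exp (\<i> * d * t)\<close>, as a function of the integer frequency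
  \<open>d\<close>.\<close>

definition phase :: "nat \<Rightarrow> real \<Rightarrow> int \<Rightarrow> complex" where
  "phase l t d = (\<i> * of_int d) ^ l * exp (\<i> * of_real (real_of_int d * t))"

lemma phase_bounded:
  assumes "l \<le> K"
  shows "poly_bounded 1 K (phase l t)"
  unfolding poly_bounded_def
proof
  fix d
  have "cmod (phase l t d) = \<bar>real_of_int d\<bar> ^ l" by (simp add: phase_def norm_mult norm_power)
  also have "\<dots> \<le> (1 + \<bar>real_of_int d\<bar>) ^ l" by (intro power_mono) auto
  also have "\<dots> \<le> (1 + \<bar>real_of_int d\<bar>) ^ K" using assms by (intro power_increasing) auto
  finally show "cmod (phase l t d) \<le> 1 * (1 + \<bar>real_of_int d\<bar>) ^ K" by simp
qed

text \<open>The second-order remainder adds two powers of \<open>d\<close> to the \<open>l\<close>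
  already present and, after division by \<open>h\<close>, leaves one factor of \<open>h\<close>.
  The symbol is spelled out as a nested linear combination to match
  \<open>symbol_op_lincomb_symbol\<close>.\<close>

lemma phase_quotient_bounded:
  assumes "h \<noteq> 0" "l + 2 \<le> K"
  shows "poly_bounded \<bar>h\<bar> K (\<lambda>d. 1 * (of_real (1/h) * phase l (t + h) d + of_real (-1/h) * phase l t d) + (-1) * phase (Suc l) t d)"
  unfolding poly_bounded_def
proof
  fix d
  define x where "x = real_of_int d"
  let ?c = "1 * (of_real (1/h) * phase l (t + h) d + of_real (-1/h) * phase l t d) + (-1) * phase (Suc l) t d"
  have "of_real h * ?c = (\<i> * of_real x) ^ l * exp (\<i> * of_real (x * t)) *
      (exp (\<i> * of_real (x * h)) - 1 - \<i> * of_real (x * h))"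
    using \<open>h \<noteq> 0\<close> by (simp add: phase_def x_def algebra_simps exp_add)
  then have "\<bar>h\<bar> * cmod ?c = \<bar>x\<bar> ^ l * cmod (exp (\<i> * of_real (x * h)) - 1 - \<i> * of_real (x * h))"
    by (metis (no_types, lifting) norm_mult norm_of_real norm_power norm_exp_i_times norm_ii mult_1 mult.right_neutral)
  also have "\<dots> \<le> \<bar>x\<bar> ^ l * (x * h)\<^sup>2" by (intro mult_left_mono exp_i_remainder) auto
  also have "\<dots> = \<bar>h\<bar> * (\<bar>h\<bar> * \<bar>x\<bar> ^ (l + 2))"
  proof -
    have "(x * h)\<^sup>2 = (\<bar>x\<bar> * \<bar>h\<bar>)\<^sup>2" by (simp flip: abs_mult)
    then show ?thesis by (simp only: power_add power2_eq_square mult_ac)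
  qed
  finally have "cmod ?c \<le> \<bar>h\<bar> * \<bar>x\<bar> ^ (l + 2)" using \<open>h \<noteq> 0\<close> by (simp add: mult_le_cancel_left)
  also have "\<dots> \<le> \<bar>h\<bar> * (1 + \<bar>x\<bar>) ^ (l + 2)" by (intro mult_left_mono power_mono) auto
  also have "\<dots> \<le> \<bar>h\<bar> * (1 + \<bar>x\<bar>) ^ K" using assms by (intro mult_left_mono power_increasing) auto
  finally show "cmod ?c \<le> \<bar>h\<bar> * (1 + \<bar>real_of_int d\<bar>) ^ K" unfolding x_def .
qed

text \<open>By linearity in the symbol the error of the difference quotient is itself a symbol
  operator, of norm at most \<open>op_const K\<close> times \<open>\<bar>h\<bar>\<close>.\<close>

lemma symbol_op_phase_derivative:
  assumes "l + 2 \<le> K" and s: "s + 2 \<ge> 2 * real K"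
  shows "has_op_derivative (-2) s (\<lambda>t. symbol_op (phase l t)) (symbol_op (phase (Suc l) t)) t"
  unfolding has_op_derivative_def
proof
  show "symbol_op (phase (Suc l) t) \<in> bounded_ops (-2) s"
    by (rule symbol_op_in_bounded_ops[OF phase_bounded s]) (use assms in simp)
  let ?T = "\<lambda>h f z. (symbol_op (phase l (t + h)) f z - symbol_op (phase l t) f z) / complex_of_real h
      - symbol_op (phase (Suc l) t) f z"
  have bd: "poly_bounded 1 K (phase l t')" "poly_bounded 1 K (phase (Suc l) t')" for t'
    by (rule phase_bounded; use assms in simp)+
  have bounds: "0 \<le> op_norm (-2) s (?T h) \<and> op_norm (-2) s (?T h) \<le> op_const K * \<bar>h\<bar>" if h: "h \<noteq> 0" for h
  proof -
    have "?T h f = symbol_op (\<lambda>d. 1 * (of_real (1/h) * phase l (t + h) d + of_real (-1/h) * phase l t d)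
        + (-1) * phase (Suc l) t d) f" if f: "f \<in> besov (-2)" for f
      by (simp only: symbol_op_lincomb_symbol[OF f poly_bounded_lincomb[OF bd(1) bd(1)] bd(2)]
          symbol_op_lincomb_symbol[OF f bd(1) bd(1)])
         (simp add: field_simps diff_divide_distrib)
    from op_norm_symbol_op[OF this phase_quotient_bounded[OF h assms(1)] s] show ?thesis by blast
  qed
  show "((\<lambda>h. op_norm (-2) s (?T h)) \<longlongrightarrow> 0) (at 0)"
  proof (rule tendsto_sandwich[of "\<lambda>_. 0" _ _ "\<lambda>h. op_const K * \<bar>h\<bar>"])
    show "((\<lambda>h. op_const K * \<bar>h\<bar>) \<longlongrightarrow> 0) (at 0)"
      by (intro tendsto_eq_intros) auto
  qed (use bounds in \<open>auto simp: eventually_at_filter\<close>)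
qed

text \<open>Induction over a variable starting order \<open>i\<close>, since differentiation raises
  it by one. The extra 1 serves the last difference quotient, which starts at order
  \<open>i + j - 1\<close> and needs growth exponent \<open>i + j + 1\<close>.\<close>

lemma symbol_op_phase_differentiable:
  assumes "i + j + 1 \<le> K" and s: "s + 2 \<ge> 2 * real K"
  shows "op_differentiable (-2) s j (\<lambda>t. symbol_op (phase i t))"
  using assms(1)
proof (induction j arbitrary: i)
  case 0
  then show ?case using symbol_op_in_bounded_ops[OF phase_bounded s] by simp
next
  case (Suc j)
  have "symbol_op (phase i t) \<in> bounded_ops (-2) s" for t
    by (rule symbol_op_in_bounded_ops[OF phase_bounded s]) (use Suc.prems in simp)
  moreover have "has_op_derivative (-2) s (\<lambda>t. symbol_op (phase i t)) (symbol_op (phase (Suc i) t)) t" for t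
    by (rule symbol_op_phase_derivative[OF _ s]) (use Suc.prems in simp)
  moreover have "op_differentiable (-2) s j (\<lambda>t. symbol_op (phase (Suc i) t))"
    by (rule Suc.IH) (use Suc.prems in simp)
  ultimately show ?case
    unfolding op_differentiable.simps by (intro conjI allI exI[of _ "\<lambda>t. symbol_op (phase (Suc i) t)"])
qed

end

section \<open>The projections\<close>

text \<open>Moving \<open>Z1 ^ k - lam\<close> to the other side of the inner product turns
  orthogonality into a recurrence for the array \<open>b\<close>; monomials as test polynomials
  extract it.\<close>

lemma besov_orth_ideal_iff:
  "f \<in> besov_orth (-2) (poly2_fun ` principal_ideal (Z1 ^ k - [:[:lam:]:])) \<longleftrightarrow>
     f \<in> besov (-2) \<and>
     (\<forall>m n. taylor_coeff f (m + k) n / of_nat ((m + k + n) choose n) =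
             cnj lam * (taylor_coeff f m n / of_nat ((m + n) choose n)))"
proof (cases "f \<in> besov (-2)")
  case True
  define b where "b m n = taylor_coeff f m n / of_nat ((m + n) choose n)" for m n
  have cf: "coeff (coeff ((Z1 ^ k - [:[:lam:]:]) * q) n) m =
      (if k \<le> m then coeff (coeff q n) (m - k) else 0) - lam * coeff (coeff q n) m" for q n m
  proof -
    have "Z1 ^ k = [:monom 1 k:]"
      by (induction k) (simp_all add: Z1_def monom_0 monom_Suc one_pCons)
    then show ?thesis by (simp add: left_diff_distrib coeff_monom_mult)
  qed
  have inner: "besov_inner (-2) f (poly2_fun ((Z1 ^ k - [:[:lam:]:]) * q)) =
      (\<Sum>\<^sub>\<infinity>(m, n). (b (m + k) n - cnj lam * b m n) * cnj (coeff (coeff q n) m))" for q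
  proof -
    let ?c = "\<lambda>m n. coeff (coeff q n) m"
    \<comment> \<open>A polynomial has finitely many nonzero coefficients, so every sum against them
      converges.\<close>
    have "finite (SIGMA n:{..degree q}. {..degree (coeff q n)})" by auto
    then have "finite ((\<lambda>(n, m). (m, n)) ` (SIGMA n:{..degree q}. {..degree (coeff q n)}))" by simp
    moreover have "{(m, n). ?c m n \<noteq> 0} \<subseteq> (\<lambda>(n, m). (m, n)) ` (SIGMA n:{..degree q}. {..degree (coeff q n)})"
      by (force intro: le_degree simp: image_iff)
    ultimately have fin: "finite {(m, n). ?c m n \<noteq> 0}" by (rule finite_subset[rotated])
    have summ: "(\<lambda>(m, n). g m n * cnj (?c m n)) summable_on UNIV" for g
      by (rule finite_nonzero_values_imp_summable_on, rule finite_subset[OF _ fin]) auto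
    let ?s = "\<lambda>(m, n). (m + k, n :: nat)"
    have inj: "inj_on ?s UNIV" by (auto simp: inj_on_def)
    let ?g = "\<lambda>(m, n). b m n * cnj (if k \<le> m then ?c (m - k) n else 0)"
    define s1 where "s1 = (\<Sum>\<^sub>\<infinity>(m, n). b (m + k) n * cnj (?c m n))"
    have 3: "((\<lambda>(m, n). b (m + k) n * cnj (?c m n)) has_sum s1) UNIV"
      using summ by (simp add: s1_def)
    also have "(\<lambda>(m, n). b (m + k) n * cnj (?c m n)) = ?g \<circ> ?s" by auto
    finally have "(?g has_sum s1) (range ?s)"
      by (simp only: has_sum_reindex[OF inj])
    \<comment> \<open>Indices with \<open>m < k\<close> lie outside the range of the shift and carry
      the coefficient 0.\<close>
    also have "?this \<longleftrightarrow> (?g has_sum s1) UNIV"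
    proof (rule has_sum_cong_neutral)
      fix x assume x: "x \<in> UNIV - range ?s"
      obtain m n where mn: "x = (m, n)" by (cases x)
      have "\<not> k \<le> m"
      proof
        assume "k \<le> m"
        then have "x = ?s (m - k, n)" using mn by simp
        with x show False by blast
      qed
      then show "?g x = 0" by (simp add: mn)
    qed auto
    finally have 1: "(?g has_sum s1) UNIV" .
    have 2: "((\<lambda>(m, n). cnj lam * b m n * cnj (?c m n)) has_sum (\<Sum>\<^sub>\<infinity>(m, n). cnj lam * b m n * cnj (?c m n))) UNIV"
      using summ by simp
    have "besov_inner (-2) f (poly2_fun ((Z1 ^ k - [:[:lam:]:]) * q)) =
        infsum (\<lambda>x. ?g x + - (case x of (m, n) \<Rightarrow> cnj lam * b m n * cnj (?c m n))) UNIV"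
    proof -
      have "F * cnj (X - lam * Y) * of_real (1 / real B) =
          F / of_nat B * cnj X + - (cnj lam * (F / of_nat B) * cnj Y)" for F X Y B
        by (simp add: right_diff_distrib diff_divide_distrib)
      then show ?thesis
        unfolding besov_inner_def poly2_fun_analytic cf b_def besov_weight_DA by (simp only: case_prod_unfold)
    qed
    also have "\<dots> = s1 + - (\<Sum>\<^sub>\<infinity>(m, n). cnj lam * b m n * cnj (?c m n))"
      by (intro infsumI has_sum_add 1 has_sum_uminusI 2)
    also have "\<dots> = infsum (\<lambda>x. (case x of (m, n) \<Rightarrow> b (m + k) n * cnj (?c m n)) + - (case x of (m, n) \<Rightarrow> cnj lam * b m n * cnj (?c m n))) UNIV"
      by (rule sym, intro infsumI has_sum_add 3 has_sum_uminusI 2)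
    also have "\<dots> = (\<Sum>\<^sub>\<infinity>(m, n). (b (m + k) n - cnj lam * b m n) * cnj (?c m n))"
      by (intro infsum_cong) (auto simp: algebra_simps)
    finally show ?thesis .
  qed
  have "(\<forall>q. besov_inner (-2) f (poly2_fun ((Z1 ^ k - [:[:lam:]:]) * q)) = 0) \<longleftrightarrow>
      (\<forall>m n. b (m + k) n = cnj lam * b m n)" (is "?L \<longleftrightarrow> ?R")
  proof
    assume L: ?L
    show ?R
    proof (intro allI)
      \<comment> \<open>The monomial with exponents \<open>m\<close> and \<open>n\<close> leaves
        exactly one term of the sum.\<close>
      fix m n
      have "(\<Sum>\<^sub>\<infinity>(m', n'). (b (m' + k) n' - cnj lam * b m' n') * cnj (coeff (coeff (monom (monom 1 m) n) n') m')) =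
          (\<Sum>\<^sub>\<infinity>(m', n')\<in>{(m, n)}. (b (m' + k) n' - cnj lam * b m' n') * cnj (coeff (coeff (monom (monom 1 m) n) n') m'))"
        by (rule infsum_cong_neutral) (auto split: if_splits)
      then show "b (m + k) n = cnj lam * b m n"
        using L inner[of "monom (monom 1 m) n"] by simp
    qed
  next
    assume ?R
    then show ?L unfolding inner by (simp add: case_prod_unfold)
  qed
  with True show ?thesis
    unfolding besov_orth_def principal_ideal_def b_def by auto
next
  case False
  then show ?thesis by (simp add: besov_orth_def)
qed

section \<open>The inner product of the Drury-Arveson space\<close>

lemma besov_inner_DA:
  "besov_inner (-2) f g =
     (\<Sum>\<^sub>\<infinity>(m, n). taylor_coeff f m n * cnj (taylor_coeff g m n) / of_nat ((m + n) choose n))"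
  unfolding besov_inner_def by (intro infsum_cong) (auto simp: besov_weight_DA)

lemma besov_inner_self_eq_0_imp:
  assumes f: "f \<in> besov (-2)" and 0: "besov_inner (-2) f f = 0"
  shows "f = (\<lambda>_. 0)"
proof (rule analytic_ball_eqI)
  fix m n
  have "(\<Sum>\<^sub>\<infinity>x. complex_of_real (case x of (m, n) \<Rightarrow> (cmod (taylor_coeff f m n))\<^sup>2 / real ((m + n) choose n))) = 0"
    using 0 unfolding besov_inner_DA
    by (subst infsum_cong[of _ _ "\<lambda>(m, n). taylor_coeff f m n * cnj (taylor_coeff f m n) / of_nat ((m + n) choose n)"])
       (auto simp flip: complex_norm_square)
  then have "(\<Sum>\<^sub>\<infinity>(m, n). (cmod (taylor_coeff f m n))\<^sup>2 / real ((m + n) choose n)) \<le> 0"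
    by (simp add: infsum_complex_of_real)
  from nonneg_infsum_le_0D[OF this besov_DA_D(2)[OF f, unfolded DA_summable_def], of "(m, n)"]
  show "taylor_coeff f m n = taylor_coeff (\<lambda>_. 0) m n" by (auto simp: analytic_ball_zero)
qed (use f in \<open>auto simp: besov_DA_iff analytic_ball_zero\<close>)

lemma besov_inner_diff_left:
  assumes "f \<in> besov (-2)" "g \<in> besov (-2)" "h \<in> besov (-2)"
  shows "besov_inner (-2) (\<lambda>z. f z - g z) h = besov_inner (-2) f h - besov_inner (-2) g h"
proof -
  let ?t = "\<lambda>f (m, n). taylor_coeff f m n * cnj (taylor_coeff h m n) / of_nat ((m + n) choose n)"
  have s: "(?t f has_sum besov_inner (-2) f h) UNIV" if "f \<in> besov (-2)" for f
    unfolding besov_inner_DA using DA_summable_mult[of "taylor_coeff f" "taylor_coeff h"] that assms(3)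
    by (simp add: besov_DA_iff)
  have d: "taylor_coeff (\<lambda>z. f z - g z) = (\<lambda>m n. taylor_coeff f m n - taylor_coeff g m n)"
    using analytic_ball_lincomb(2)[of f g 1 "-1"] assms by (simp add: besov_DA_iff)
  have "((\<lambda>x. ?t f x + - ?t g x) has_sum (besov_inner (-2) f h + - besov_inner (-2) g h)) UNIV"
    by (intro has_sum_add has_sum_uminusI s assms)
  then show ?thesis
    unfolding besov_inner_DA[of "\<lambda>z. f z - g z"] d
    by (intro infsumI) (simp add: case_prod_unfold diff_divide_distrib left_diff_distrib)
qed

lemma besov_diff: "f \<in> besov (-2) \<Longrightarrow> g \<in> besov (-2) \<Longrightarrow> (\<lambda>z. f z - g z) \<in> besov (-2)"
  using besov_DA_lincomb[of f g 1 "-1"] by simp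

section \<open>Identification of the projection\<close>

context ideal_params begin

text \<open>The phase factors into a row and a column part, which shows the rank-one form on each
  line: an inner product with the spanning vector, divided by its squared norm, times that
  vector.\<close>

lemma op_coeff_phase_0:
  fixes t :: real
  defines "lam \<equiv> of_real \<epsilon> * exp (\<i> * of_real t)"
  shows "op_coeff (phase 0 t) a m n / of_nat ((m + n) choose n) =
     cnj lam ^ (m div k) / of_real (energy (m mod k) n) * (\<Sum>\<^sub>\<infinity>q. lam ^ q * a (m mod k + k * q) n)"
proof -
  define p where "p = m div k"
  define r where "r = m mod k"
  have cl: "cnj lam = of_real \<epsilon> * exp (- (\<i> * of_real t))"
    by (simp add: lam_def exp_cnj)
  have "phase 0 t (int q - int p) * of_real (\<epsilon> ^ q) * a (r + k * q) n =
      exp (- (\<i> * of_real t)) ^ p * (lam ^ q * a (r + k * q) n)" for q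
    by (simp add: phase_def lam_def power_mult_distrib exp_of_nat_mult[symmetric] exp_diff exp_minus
        field_simps flip: exp_add)
  then have "(\<Sum>\<^sub>\<infinity>q. phase 0 t (int q - int p) * of_real (\<epsilon> ^ q) * a (r + k * q) n) =
      exp (- (\<i> * of_real t)) ^ p * (\<Sum>\<^sub>\<infinity>q. lam ^ q * a (r + k * q) n)"
    by (simp only: infsum_cmult_right')
  then show ?thesis
    unfolding op_coeff_def p_def[symmetric] r_def[symmetric]
    by (simp add: cl power_mult_distrib field_simps)
qed

text \<open>\<open>orth_proj\<close> is a definite description, so the candidate \<open>g\<close>
  must lie in the complement \<open>V\<close>, leave a residual orthogonal to \<open>V\<close>, and
  be the only such element.\<close>

lemma P_eq_symbol_op:
  assumes f: "f \<in> besov (-2)"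
  shows "P k \<epsilon> t f = symbol_op (phase 0 t) f"
proof -
  define lam where "lam = of_real \<epsilon> * exp (\<i> * of_real t)"
  define V where "V = besov_orth (-2) (poly2_fun ` principal_ideal (Z1 ^ k - [:[:lam:]:]))"
  define g where "g = symbol_op (phase 0 t) f"
  have bd: "poly_bounded 1 0 (phase 0 t)" by (rule phase_bounded) simp
  note c = symbol_op_analytic[OF f bd, folded g_def]
  \<comment> \<open>A phase of modulus 1 has growth exponent 0, so no weight is lost and the target
    may be \<open>besov (-2)\<close> itself.\<close>
  have g: "g \<in> besov (-2)" unfolding g_def by (rule symbol_op_bound(1)[OF f bd]) simp
  have V: "h \<in> V \<longleftrightarrow> h \<in> besov (-2) \<and>
     (\<forall>m n. taylor_coeff h (m + k) n / of_nat ((m + k + n) choose n) =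
             cnj lam * (taylor_coeff h m n / of_nat ((m + n) choose n)))" for h
    unfolding V_def by (rule besov_orth_ideal_iff)
  \<comment> \<open>Passing from \<open>m\<close> to \<open>m + k\<close> keeps
    \<open>m mod k\<close> and raises \<open>m div k\<close> by one, which contributes one factor
    \<open>cnj lam\<close>.\<close>
  have gV: "g \<in> V"
    unfolding V c using g k by (simp add: op_coeff_phase_0 flip: lam_def)
  have orth: "besov_inner (-2) (\<lambda>z. f z - g z) h = 0" if h: "h \<in> V" for h
  proof -
    have hb: "h \<in> besov (-2)" using h V by blast
    define a where "a = taylor_coeff f"
    define e where "e = taylor_coeff h"
    define b where "b = op_coeff (phase 0 t) a"
    define S where "S r n = (\<Sum>\<^sub>\<infinity>q. lam ^ q * a (r + k * q) n)" for r n
    have a: "DA_summable a" using f by (simp add: a_def besov_DA_iff)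
    \<comment> \<open>The recurrence makes \<open>h\<close> a multiple of the spanning vector on
      every line.\<close>
    have e: "e (r + k * p) n / of_nat ((r + k * p + n) choose n) = cnj lam ^ p * (e r n / of_nat ((r + n) choose n))" for r p n
    proof (induction p)
      case (Suc p)
      have "r + k * Suc p = r + k * p + k" by simp
      then show ?case using h Suc by (simp only: V e_def) simp
    qed simp
    have as: "((\<lambda>p. lam ^ p * a (r + k * p) n) has_sum S r n) UNIV" if "r < k" for r n
      using op_coeff_row_summable[OF a bd, of r n] that
      by (simp add: S_def phase_def lam_def power_mult_distrib exp_of_nat_mult[symmetric] mult_ac)
    have "norm lam = \<epsilon>" using \<epsilon> by (simp add: lam_def norm_mult)
    then have ll: "lam * cnj lam = of_real (\<epsilon>\<^sup>2)" by (metis complex_norm_square)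
    \<comment> \<open>\<open>g\<close> has the same pairing \<open>S r n\<close> with the spanning
      vector as \<open>f\<close>, because the energy in its denominator cancels; so each line
      contributes 0 to the inner product of \<open>f - g\<close> with \<open>h\<close>.\<close>
    have bs: "((\<lambda>p. lam ^ p * b (r + k * p) n) has_sum S r n) UNIV" if r: "r < k" for r n
    proof -
      have "((\<lambda>p. of_real ((\<epsilon>\<^sup>2) ^ p * real ((r + k * p + n) choose n)) * (S r n / of_real (energy r n))) has_sum
          of_real (energy r n) * (S r n / of_real (energy r n))) UNIV"
        by (intro has_sum_cmult_left has_sum_of_real energy_has_sum)
      moreover have "lam ^ p * b (r + k * p) n =
          of_real ((\<epsilon>\<^sup>2) ^ p * real ((r + k * p + n) choose n)) * (S r n / of_real (energy r n))" for p
      proof -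
        have "b (r + k * p) n = (cnj lam ^ p / of_real (energy r n) * S r n) * of_nat ((r + k * p + n) choose n)"
          using op_coeff_phase_0[of t a "r + k * p" n, folded lam_def b_def] r
          by (simp add: S_def divide_eq_eq)
        then have "lam ^ p * b (r + k * p) n = (lam * cnj lam) ^ p * (of_nat ((r + k * p + n) choose n) * (S r n / of_real (energy r n)))"
          by (simp add: power_mult_distrib)
        then show ?thesis unfolding ll by (simp add: mult_ac)
      qed
      ultimately show ?thesis using energy_pos[of r n] by simp
    qed
    have fg: "(\<lambda>z. f z - g z) \<in> besov (-2)" by (rule besov_diff[OF f g])
    have d: "taylor_coeff (\<lambda>z. f z - g z) = (\<lambda>m n. a m n - b m n)"
      using analytic_ball_lincomb(2)[of f g 1 "-1"] f g by (simp add: besov_DA_iff a_def b_def c)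
    let ?T = "besov_inner (-2) (\<lambda>z. f z - g z) h"
    have "((\<lambda>(m, n). (a m n - b m n) * cnj (e m n) / of_nat ((m + n) choose n)) has_sum ?T) UNIV"
      unfolding besov_inner_DA d e_def[symmetric]
      using DA_summable_mult[OF besov_DA_D(2)[OF fg] besov_DA_D(2)[OF hb]] by (simp add: d e_def)
    then have *: "((\<lambda>((r, n), p). (a (r + k * p) n - b (r + k * p) n) * cnj (e (r + k * p) n) / of_nat ((r + k * p + n) choose n))
        has_sum ?T) (({..<k} \<times> UNIV) \<times> UNIV)"
      unfolding has_sum_blocks by simp
    have "((\<lambda>_. 0) has_sum ?T) ({..<k} \<times> (UNIV :: nat set))"
    proof (rule has_sum_SigmaD[OF *])
      fix x :: "nat \<times> nat" assume "x \<in> {..<k} \<times> UNIV"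
      then obtain r n where x: "x = (r, n)" and r: "r < k" by auto
      have "((\<lambda>p. (lam ^ p * a (r + k * p) n + - (lam ^ p * b (r + k * p) n)) * cnj (e r n / of_nat ((r + n) choose n)))
          has_sum (S r n + - S r n) * cnj (e r n / of_nat ((r + n) choose n))) UNIV"
        by (intro has_sum_cmult_left has_sum_add has_sum_uminusI as bs r)
      moreover have "(a (r + k * p) n - b (r + k * p) n) * cnj (e (r + k * p) n) / of_nat ((r + k * p + n) choose n) =
          (lam ^ p * a (r + k * p) n + - (lam ^ p * b (r + k * p) n)) * cnj (e r n / of_nat ((r + n) choose n))" for p
      proof -
        have E: "cnj (e (r + k * p) n) / of_nat ((r + k * p + n) choose n) =
            lam ^ p * cnj (e r n / of_nat ((r + n) choose n))"
          using arg_cong[OF e[of r p n], of cnj] by simp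
        have "(x - y) * (l * w) = (l * x + - (l * y)) * w" for x y l w :: complex
          by (simp add: algebra_simps)
        then show ?thesis unfolding times_divide_eq_right[symmetric] E .
      qed
      ultimately show "((\<lambda>p. (\<lambda>((r, n), p). (a (r + k * p) n - b (r + k * p) n) * cnj (e (r + k * p) n)
          / of_nat ((r + k * p + n) choose n)) (x, p)) has_sum 0) UNIV"
        by (simp add: x)
    qed
    from has_sum_unique[OF this has_sum_0_simp] show "?T = 0" .
  qed
  have "(THE g. g \<in> V \<and> (\<forall>h\<in>V. besov_inner (-2) (\<lambda>z. f z - g z) h = 0)) = g"
  proof (rule the_equality)
    fix g' assume g': "g' \<in> V \<and> (\<forall>h\<in>V. besov_inner (-2) (\<lambda>z. f z - g' z) h = 0)"
    then have g'b: "g' \<in> besov (-2)" using V by blast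
    let ?d = "\<lambda>z. g' z - g z"
    have db: "?d \<in> besov (-2)" by (rule besov_diff[OF g'b g])
    have "taylor_coeff ?d = (\<lambda>m n. taylor_coeff g' m n - taylor_coeff g m n)"
      using analytic_ball_lincomb(2)[of g' g 1 "-1"] g'b g by (simp add: besov_DA_iff)
    then have dV: "?d \<in> V"
      using g' gV db unfolding V by (simp add: diff_divide_distrib right_diff_distrib)
    \<comment> \<open>Both residuals are orthogonal to \<open>?d\<close>, which lies in
      \<open>V\<close>; subtracting them leaves \<open>?d\<close> orthogonal to itself.\<close>
    have "besov_inner (-2) ?d ?d = 0"
      using g' orth[OF dV] dV besov_inner_diff_left[OF f g db] besov_inner_diff_left[OF f g'b db]
        besov_inner_diff_left[OF g'b g db] by auto
    from besov_inner_self_eq_0_imp[OF db this] show "g' = g" by (auto simp: fun_eq_iff)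
  qed (use gV orth in auto)
  then show ?thesis
    using f by (simp add: P_def orth_proj_def V_def lam_def g_def)
qed

lemma besov_inclusion_P: "besov_inclusion (-2) \<circ> P k \<epsilon> t = symbol_op (phase 0 t)"
proof
  fix f
  show "(besov_inclusion (-2) \<circ> P k \<epsilon> t) f = symbol_op (phase 0 t) f"
  proof (cases "f \<in> besov (-2)")
    case True
    then show ?thesis
      using P_eq_symbol_op[OF True, of t] symbol_op_bound(1)[OF True phase_bounded[of 0 0 t], of "-2"]
      by (simp add: besov_inclusion_def)
  next
    case False
    then show ?thesis by (simp add: besov_inclusion_def P_def orth_proj_def symbol_op_def)
  qed
qed

end

theorem theorem2p11:
  fixes k :: nat and \<epsilon> :: real
  assumes "k \<ge> 1" and "0 < \<epsilon>" and "\<epsilon> < 1"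
  shows "op_differentiable (-2) 4 1 (\<lambda>t. besov_inclusion (-2) \<circ> P k \<epsilon> t) \<and>
    (\<forall>(l::nat) (\<sigma>::real). l \<ge> 1 \<longrightarrow> \<sigma> > 0 \<longrightarrow>
       op_differentiable (-2) (2 * real l + 1 + \<sigma>) l (\<lambda>t. besov_inclusion (-2) \<circ> P k \<epsilon> t))"
proof -
  interpret ideal_params k \<epsilon> by unfold_locales (use assms in auto)
  \<comment> \<open>With \<open>K = l + 1\<close> the condition \<open>s + 2 \<ge> 2 * K\<close>
    reads \<open>s \<ge> 2 * l\<close>, satisfied by \<open>s = 4\<close> with \<open>l = 1\<close>
    and by \<open>s = 2 * l + 1 + \<sigma>\<close>.\<close>
  have *: "op_differentiable (-2) s l (\<lambda>t. besov_inclusion (-2) \<circ> P k \<epsilon> t)" if "s \<ge> 2 * real l" for s l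
    unfolding besov_inclusion_P
    by (rule symbol_op_phase_differentiable[of 0 l "Suc l"]) (use that in auto)
  show ?thesis by (intro conjI allI impI *) auto
qed

end
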